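(* Let $p\in\mathbb{N}\cup\{0\}$. A cell-centered finite-volume scheme with the $p$-th order polynomial reconstruction on a 1-periodic simplicial mesh (as defined in the context) has zero mean error on the $(p+1)$-th order polynomials, i.e. $$\sum_{j\in\mathcal{E}^1}|K_j|\,\epsilon_j(f,\Pi)=0\quad\text{for each } f\in(P_{p+1})^n .$$
   Context: System: $\partial_t w+\boldsymbol{A}\cdot\nabla w=0$ in $\mathbb{R}^d$, $\boldsymbol{A}=(A_1,\dots,A_d)$ constant real $n\times n$ matrices, $\boldsymbol{A}\cdot\boldsymbol e=\sum_i e_iA_i$ diagonalizable over $\mathbb{R}$ for each $\boldsymbol e\in\mathbb{R}^d$; $\boldsymbol{A}\cdot\nabla f=\sum_iA_i\partial f/\partial x_i$. For $B=S\Lambda S^{-1}$ with $\Lambda$ real diagonal, $|B|=S|\Lambda|S^{-1}$. $P_q$: polynomials in $d$ variables of degree at most $q$. Mesh: a conforming simplicial mesh of $\mathbb{R}^d$ invariant under translations by integer vectors, with finitely many elements per unit cube. $\mathcal{E}$ is the set of elements; $K_j$ is the simplex $j\in\mathcal{E}$ and $|K_j|$ its measure. $\mathcal{E}^1$ is the set of elements modulo integer translations. $N(j)$ is the set of elements sharing a face with $j$; $\boldsymbol n_{jk}=\int_{\partial K_j\cap\partial K_k}\boldsymbol n\,dS$ with $\boldsymbol n$ the unit normal pointing into $K_k$. $\Pi$ maps a continuous function to its averages over the elements. Scheme: $\frac{du_j}{dt}+\frac{1}{|K_j|}\sum_{k\in N(j)}F_{jk}[u]=0$, with upwind fluxes $$F_{jk}[u]=\frac{\boldsymbol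 A\cdot\boldsymbol n_{jk}+|\boldsymbol A\cdot\boldsymbol n_{jk}|}{2}\mathcal{R}_{jk}[u]+\frac{\boldsymbol A\cdot\boldsymbol n_{jk}-|\boldsymbol A\cdot\boldsymbol n_{jk}|}{2}\mathcal{R}_{kj}[u].$$ $\mathcal{R}_{jk}$ acts componentwise; for scalar $u$, with a finite reconstruction stencil $S_j\subset\mathcal{E}$, $j\in S_j$, $|S_j|\ge\dim P_p$, and weights $w_{jk}>0$ (stencils and weights translation-invariant), $p_j\in P_p$ is the minimizer of $\sum_{k\in S_j}w_{jk}\bigl(u_k-\frac{1}{|K_k|}\int_{K_k}p_j\,dv\bigr)^2$ among $p_j\in P_p$ satisfying $\frac1{|K_j|}\int_{K_j}p_j\,dv=u_j$ (assumed unique, i.e. the only element of $P_p$ with zero averages over all $K_k$, $k\in S_j$, is $0$), and $\mathcal{R}_{jk}[u]$ is the average of $p_j$ over the face $\partial K_j\cap\partial K_k$. Truncation error: $\epsilon_j(f,\Pi)=-(\Pi(\boldsymbol A\cdot\nabla f))_j+\frac{1}{|K_j|}\sum_{k\in N(j)}F_{jk}[\Pi f]$. *)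

theory Defs
  imports "HOL-Analysis.Analysis"
begin

section \<open>Hyperbolic systems with constant coefficients\<close>

definition diagonal_mat :: "real^'n^'n \<Rightarrow> bool" where
  "diagonal_mat D \<longleftrightarrow> (\<forall>i j. i \<noteq> j \<longrightarrow> D $ i $ j = 0)"

definition real_diagonalizable :: "real^'n^'n \<Rightarrow> bool" where
  "real_diagonalizable B \<longleftrightarrow>
    (\<exists>S D :: real^'n^'n. invertible S \<and> diagonal_mat D \<and> B = S ** D ** matrix_inv S)"

(* For diagonalizable B the result does not depend on the diagonalization chosen;
   for other B the value is unspecified. *)
definition matrix_abs :: "real^'n^'n \<Rightarrow> real^'n^'n" where
  "matrix_abs B = (THE C. \<exists>S D :: real^'n^'n. invertible S \<and> diagonal_mat D \<and> B = S ** D ** matrix_inv S \<and>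
      C = S ** (\<chi> i j. \<bar>D $ i $ j\<bar>) ** matrix_inv S)"

definition mat_dot :: "('d::finite \<Rightarrow> real^'n^'n) \<Rightarrow> real^'d \<Rightarrow> real^'n^'n" where
  "mat_dot A e = (\<Sum>i\<in>UNIV. (e $ i) *\<^sub>R A i)"

definition hyperbolic :: "('d::finite \<Rightarrow> real^'n^'n) \<Rightarrow> bool" where
  "hyperbolic A \<longleftrightarrow> (\<forall>e. real_diagonalizable (mat_dot A e))"

definition mat_dot_grad :: "('d::finite \<Rightarrow> real^'n^'n) \<Rightarrow> (real^'d \<Rightarrow> real^'n) \<Rightarrow> real^'d \<Rightarrow> real^'n" where
  "mat_dot_grad A f x = (\<Sum>i\<in>UNIV. A i *v frechet_derivative f (at x) (axis i 1))"


section \<open>Polynomials of bounded total degree\<close>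

definition exponents :: "nat \<Rightarrow> ('d::finite \<Rightarrow> nat) set" where
  "exponents q = {\<alpha>. (\<Sum>i\<in>UNIV. \<alpha> i) \<le> q}"

definition polys :: "nat \<Rightarrow> (real^'d \<Rightarrow> real) set" where
  "polys q = {f. \<exists>c. f = (\<lambda>x. \<Sum>\<alpha>\<in>exponents q. c \<alpha> * (\<Prod>i\<in>UNIV. (x $ i) ^ \<alpha> i))}"

definition poly_vecs :: "nat \<Rightarrow> (real^'d \<Rightarrow> real^'n) set" where
  "poly_vecs q = {f. \<forall>i. (\<lambda>x. f x $ i) \<in> polys q}"


section \<open>Periodic simplicial meshes\<close>

definition int_vecs :: "(real^'d) set" where
  "int_vecs = {z. \<forall>i. z $ i \<in> \<int>}"

text \<open>A mesh is the set of its elements, and an element is the closed simplex itself.\<close>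

definition periodic_simplicial_mesh :: "(real^'d) set set \<Rightarrow> bool" where
  "periodic_simplicial_mesh M \<longleftrightarrow>
     (\<forall>T\<in>M. int CARD('d) simplex T) \<and>
     \<Union>M = UNIV \<and>
     (\<forall>T\<in>M. \<forall>T'\<in>M. (T \<inter> T') face_of T) \<and>
     (\<forall>T\<in>M. \<forall>z\<in>int_vecs. (+) z ` T \<in> M) \<and>
     finite {T\<in>M. T \<inter> cbox 0 1 \<noteq> {}}"

definition translation_rel :: "(real^'d) set set \<Rightarrow> ((real^'d) set \<times> (real^'d) set) set" where
  "translation_rel M = {(T, T'). T \<in> M \<and> T' \<in> M \<and> (\<exists>z\<in>int_vecs. T' = (+) z ` T)}"

abbreviation elements_mod_translations :: "(real^'d) set set \<Rightarrow> (real^'d) set set set" where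
  "elements_mod_translations M \<equiv> M // translation_rel M"

definition neighbours :: "(real^'d) set set \<Rightarrow> (real^'d) set \<Rightarrow> (real^'d) set set" where
  "neighbours M T = {T'\<in>M. (T \<inter> T') facet_of T}"


section \<open>Cell and face averages\<close>

definition cell_avg :: "(real^'d) set \<Rightarrow> (real^'d \<Rightarrow> 'b::{banach, second_countable_topology}) \<Rightarrow> 'b" where
  "cell_avg T f = (1 / measure lborel T) *\<^sub>R (LINT x:T|lborel. f x)"

text \<open>
  The surface measure on the hyperplane \<open>\<nu> \<bullet> x = c\<close>, where \<open>\<nu>\<close> is a unit vector: the part of Lebesgue
  measure lying on the slab \<open>c \<le> \<nu> \<bullet> x \<le> c + 1\<close> of thickness one, projected orthogonally onto the
  hyperplane. The surface area of a subset of the hyperplane is thus the volume of the right prism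
  of height one over it; if the space is the line, this is the unit point mass.
\<close>

definition hyperplane_measure :: "real^'d \<Rightarrow> real \<Rightarrow> (real^'d) measure" where
  "hyperplane_measure \<nu> c =
     distr (restrict_space lborel {x. c \<le> \<nu> \<bullet> x \<and> \<nu> \<bullet> x \<le> c + 1}) borel
       (\<lambda>x. x - (\<nu> \<bullet> x - c) *\<^sub>R \<nu>)"

text \<open>
  A set of codimension one lies in one hyperplane, which has the two descriptions \<open>(\<nu>, c)\<close> and
  \<open>(-\<nu>, -c)\<close>. By translation invariance of Lebesgue measure both give the same measure.
\<close>

definition facet_measure :: "(real^'d) set \<Rightarrow> (real^'d) measure" where
  "facet_measure F =
     (case (SOME (\<nu>, c). norm \<nu> = 1 \<and> F \<subseteq> {x. \<nu> \<bullet> x = c}) of (\<nu>, c) \<Rightarrow> hyperplane_measure \<nu> c)"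

definition face_avg :: "(real^'d) set \<Rightarrow> (real^'d \<Rightarrow> real) \<Rightarrow> real" where
  "face_avg F g = (LINT x:F|facet_measure F. g x) / measure (facet_measure F) F"

text \<open>The unit normal of the facet \<open>F\<close> of \<open>T\<close> pointing into \<open>T\<close>.\<close>

definition inward_normal :: "(real^'d) set \<Rightarrow> (real^'d) set \<Rightarrow> real^'d" where
  "inward_normal F T = (THE \<nu>. norm \<nu> = 1 \<and>
      (\<forall>x\<in>F. \<forall>y\<in>F. \<nu> \<bullet> (y - x) = 0) \<and> (\<forall>x\<in>F. \<forall>y\<in>T. 0 \<le> \<nu> \<bullet> (y - x)))"

definition normal_integral :: "(real^'d) set \<Rightarrow> (real^'d) set \<Rightarrow> real^'d" where
  "normal_integral T T' = (LINT x:(T \<inter> T')|facet_measure (T \<inter> T'). inward_normal (T \<inter> T') T')"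


section \<open>The finite-volume scheme with polynomial reconstruction\<close>

type_synonym 'd stencils = "(real^'d) set \<Rightarrow> (real^'d) set set"
type_synonym 'd weights = "(real^'d) set \<Rightarrow> (real^'d) set \<Rightarrow> real"

text \<open>The dimension of \<open>polys p\<close> is the number of monomials of degree at most \<open>p\<close>.\<close>

definition admissible_stencils :: "nat \<Rightarrow> (real^'d) set set \<Rightarrow> 'd stencils \<Rightarrow> 'd weights \<Rightarrow> bool" where
  "admissible_stencils p M S w \<longleftrightarrow>
     (\<forall>T\<in>M. finite (S T) \<and> S T \<subseteq> M \<and> T \<in> S T \<and>
        card (exponents p :: ('d \<Rightarrow> nat) set) \<le> card (S T) \<and>
        (\<forall>K\<in>S T. 0 < w T K) \<and>
        (\<forall>z\<in>int_vecs. S ((+) z ` T) = (\<lambda>K. (+) z ` K) ` S T \<and>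
           (\<forall>K\<in>S T. w ((+) z ` T) ((+) z ` K) = w T K)) \<and>
        (\<forall>q\<in>polys p. (\<forall>K\<in>S T. cell_avg K q = 0) \<longrightarrow> q = (\<lambda>x. 0)))"

definition reconstruction ::
    "nat \<Rightarrow> 'd::finite stencils \<Rightarrow> 'd weights \<Rightarrow> (real^'d) set \<Rightarrow> ((real^'d) set \<Rightarrow> real) \<Rightarrow> real^'d \<Rightarrow> real" where
  "reconstruction p S w T u =
     arg_min (\<lambda>q. \<Sum>K\<in>S T. w T K * (u K - cell_avg K q)\<^sup>2) (\<lambda>q. q \<in> polys p \<and> cell_avg T q = u T)"

definition face_value ::
    "nat \<Rightarrow> 'd::finite stencils \<Rightarrow> 'd weights \<Rightarrow> (real^'d) set \<Rightarrow> (real^'d) set \<Rightarrow>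
     ((real^'d) set \<Rightarrow> real^'n) \<Rightarrow> real^'n" where
  "face_value p S w T T' u = (\<chi> i. face_avg (T \<inter> T') (reconstruction p S w T (\<lambda>K. u K $ i)))"

definition upwind_flux ::
    "('d::finite \<Rightarrow> real^'n^'n) \<Rightarrow> nat \<Rightarrow> 'd stencils \<Rightarrow> 'd weights \<Rightarrow> (real^'d) set \<Rightarrow> (real^'d) set \<Rightarrow>
     ((real^'d) set \<Rightarrow> real^'n) \<Rightarrow> real^'n" where
  "upwind_flux A p S w T T' u =
     (let B = mat_dot A (normal_integral T T') in
       ((1/2) *\<^sub>R (B + matrix_abs B)) *v face_value p S w T T' u +
       ((1/2) *\<^sub>R (B - matrix_abs B)) *v face_value p S w T' T u)"

definition cell_projection :: "(real^'d \<Rightarrow> real^'n) \<Rightarrow> (real^'d) set \<Rightarrow> real^'n" where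
  "cell_projection f = (\<lambda>T. cell_avg T f)"

definition truncation_error ::
    "('d::finite \<Rightarrow> real^'n^'n) \<Rightarrow> (real^'d) set set \<Rightarrow> nat \<Rightarrow> 'd stencils \<Rightarrow> 'd weights \<Rightarrow>
     (real^'d \<Rightarrow> real^'n) \<Rightarrow> (real^'d) set \<Rightarrow> real^'n" where
  "truncation_error A M p S w f T =
     - cell_projection (mat_dot_grad A f) T +
     (1 / measure lborel T) *\<^sub>R (\<Sum>T'\<in>neighbours M T. upwind_flux A p S w T T' (cell_projection f))"

end

theory Submission
  imports Defs
begin

text \<open>
  On a cell \<open>T\<close> let \<open>r\<^sub>T\<close> be the difference of \<open>f\<close> and the reconstruction from the averages of \<open>f\<close>.
  For an integer vector \<open>z\<close> the polynomial \<open>f (x + z) - f x\<close> has degree at most \<open>p\<close>. The reconstruction is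
  linear, commutes with integer translations and reproduces polynomials of degree \<open>p\<close>, so this difference
  cancels and \<open>r\<^sub>T\<close> is periodic: \<open>r\<^bsub>z + T\<^esub> (x + z) = r\<^sub>T x\<close> (\<open>residual_periodic\<close>). This is where
  degree \<open>p + 1\<close> is enough, although such an \<open>f\<close> is not reconstructed exactly.

  The upwind flux between two cells is the exact flux of \<open>f\<close> through the common facet minus the upwind
  combination of the two residuals (\<open>upwind_flux_split\<close>). By the divergence theorem the exact fluxes of a
  cell add up to the integral of \<open>A \<bullet> \<nabla> f\<close>, the other term of the truncation error
  (\<open>exact_flux_sum\<close>). What remains in the mean error is the sum of the residual fluxes over all pairs
  of a cell in one period and a neighbour. The residual flux is antisymmetric in the two cells, as
  the normal changes sign while its matrix keeps the absolute value, and it is periodic. Thus each facet modulo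
  translations contributes two opposite terms, and the sum vanishes (\<open>antisymmetric_periodic_sum\<close>).

  The divergence theorem on a simplex is obtained without a parametrization of the facets. It suffices to
  test with the direction \<open>a - b\<close> of an edge, to which the normals of all facets but those opposite
  \<open>a\<close> and \<open>b\<close> are orthogonal. Lines in this direction cross the simplex between these two facets, and
  \<open>integral_by_parallel_lines\<close>, which follows from Fubini and translation invariance alone, reduces the
  claim to the fundamental theorem of calculus. The same lemma gives the invariance of Lebesgue measure under
  shears, hence the comparison of the orthogonal prisms that define the surface measure with oblique prisms
  (\<open>integral_hyperplane_measure_oblique\<close>). That the facets of a cell correspond to its neighbours is
  shown in \<open>neighbour_across_facet_unique\<close> and \<open>neighbour_across_facet_exists\<close>.
\<close>

section \<open>Polynomials of bounded degree\<close>

lemma finite_exponents: "finite (exponents q :: ('d::finite \<Rightarrow> nat) set)"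
proof -
  have "exponents q \<subseteq> (\<Pi>\<^sub>E i\<in>(UNIV::'d set). {..q})"
  proof
    fix \<alpha> :: "'d \<Rightarrow> nat" assume "\<alpha> \<in> exponents q"
    then have le: "(\<Sum>i\<in>UNIV. \<alpha> i) \<le> q" by (simp add: exponents_def)
    have "\<alpha> i \<le> q" for i
      using member_le_sum[of i UNIV \<alpha>] le by simp
    then show "\<alpha> \<in> (\<Pi>\<^sub>E i\<in>(UNIV::'d set). {..q})" by (auto simp: PiE_def extensional_def)
  qed
  then show ?thesis by (rule finite_subset) (intro finite_PiE, auto)
qed

definition monomial :: "('d::finite \<Rightarrow> nat) \<Rightarrow> real^'d \<Rightarrow> real" where
  "monomial \<alpha> x = (\<Prod>i\<in>UNIV. (x $ i) ^ \<alpha> i)"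

lemma polys_iff: "f \<in> polys q \<longleftrightarrow> (\<exists>c. f = (\<lambda>x. \<Sum>\<alpha>\<in>exponents q. c \<alpha> * monomial \<alpha> x))"
  by (simp add: polys_def monomial_def)

lemma polys_add:
  assumes "f \<in> polys q" "g \<in> polys q" shows "(\<lambda>x. f x + g x) \<in> polys q"
proof -
  from assms obtain c d where "f = (\<lambda>x. \<Sum>\<alpha>\<in>exponents q. c \<alpha> * monomial \<alpha> x)"
      "g = (\<lambda>x. \<Sum>\<alpha>\<in>exponents q. d \<alpha> * monomial \<alpha> x)" by (auto simp: polys_iff)
  then show ?thesis unfolding polys_iff
    by (intro exI[of _ "\<lambda>\<alpha>. c \<alpha> + d \<alpha>"]) (simp add: sum.distrib distrib_right)
qed

lemma polys_scale:
  assumes "f \<in> polys q" shows "(\<lambda>x. k * f x) \<in> polys q"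
proof -
  from assms obtain c where "f = (\<lambda>x. \<Sum>\<alpha>\<in>exponents q. c \<alpha> * monomial \<alpha> x)"
    by (auto simp: polys_iff)
  then show ?thesis unfolding polys_iff
    by (intro exI[of _ "\<lambda>\<alpha>. k * c \<alpha>"]) (simp add: sum_distrib_left mult.assoc)
qed

lemma polys_diff:
  assumes "f \<in> polys q" "g \<in> polys q" shows "(\<lambda>x. f x - g x) \<in> polys q"
  using polys_add[OF assms(1) polys_scale[OF assms(2), of "-1"]] by simp

lemma monomial_in_polys:
  assumes "\<alpha> \<in> exponents q" shows "monomial \<alpha> \<in> polys q"
  unfolding polys_iff
proof (intro exI[of _ "\<lambda>\<beta>. if \<beta> = \<alpha> then 1 else 0"] ext)
  fix x show "monomial \<alpha> x = (\<Sum>\<beta>\<in>exponents q. (if \<beta> = \<alpha> then 1 else 0) * monomial \<beta> x)"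
    using assms by (simp add: if_distrib[of "\<lambda>t. t * _"] finite_exponents cong: if_cong)
qed

lemma polys_const: "(\<lambda>x. k) \<in> polys q"
proof -
  have "monomial (\<lambda>i. 0) \<in> polys q" by (rule monomial_in_polys) (simp add: exponents_def)
  from polys_scale[OF this, of k] show ?thesis by (simp add: monomial_def)
qed

lemma polys_sum:
  assumes "finite I" "\<And>i. i \<in> I \<Longrightarrow> f i \<in> polys q" shows "(\<lambda>x. \<Sum>i\<in>I. f i x) \<in> polys q"
  using assms by (induction I rule: finite_induct) (auto intro: polys_add polys_const)

lemma polys_mono:
  assumes "q \<le> q'" "f \<in> polys q" shows "f \<in> polys q'"
proof -
  from assms obtain c where f: "f = (\<lambda>x. \<Sum>\<alpha>\<in>exponents q. c \<alpha> * monomial \<alpha> x)"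
    by (auto simp: polys_iff)
  show ?thesis unfolding f
    by (intro polys_sum polys_scale monomial_in_polys finite_exponents)
       (use assms in \<open>auto simp: exponents_def\<close>)
qed

lemma monomial_add_unit: "monomial (\<lambda>j. if j = i then Suc (\<alpha> j) else \<alpha> j) x = x $ i * monomial \<alpha> x"
proof -
  have "monomial (\<lambda>j. if j = i then Suc (\<alpha> j) else \<alpha> j) x
      = (\<Prod>j\<in>UNIV. (if j = i then x $ i else 1) * (x $ j) ^ \<alpha> j)"
    unfolding monomial_def by (rule prod.cong) auto
  then show ?thesis by (simp add: prod.distrib monomial_def)
qed

lemma sum_add_unit:
  "(\<Sum>j\<in>UNIV. if j = i then Suc (\<alpha> j) else \<alpha> j) = Suc (\<Sum>j\<in>UNIV. \<alpha> (j::'d::finite))"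
proof -
  have "(\<Sum>j\<in>UNIV. if j = i then Suc (\<alpha> j) else \<alpha> j) = (\<Sum>j\<in>UNIV. (if j = i then 1 else 0) + \<alpha> j)"
    by (rule sum.cong) auto
  then show ?thesis by (simp add: sum.distrib)
qed

lemma polys_coordinate_mult:
  assumes "f \<in> polys q" shows "(\<lambda>x. x $ i * f x) \<in> polys (Suc q)"
proof -
  from assms obtain c where f: "f = (\<lambda>x. \<Sum>\<alpha>\<in>exponents q. c \<alpha> * monomial \<alpha> x)"
    by (auto simp: polys_iff)
  have "(\<lambda>x. x $ i * f x) =
      (\<lambda>x. \<Sum>\<alpha>\<in>exponents q. c \<alpha> * monomial (\<lambda>j. if j = i then Suc (\<alpha> j) else \<alpha> j) x)"
    by (simp add: f sum_distrib_left monomial_add_unit mult_ac)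
  also have "\<dots> \<in> polys (Suc q)"
    by (intro polys_sum polys_scale monomial_in_polys finite_exponents)
       (auto simp: exponents_def sum_add_unit)
  finally show ?thesis .
qed

text \<open>Peeling one coordinate off a monomial, the shifted monomial satisfies
  \<open>(x\<^sub>i + z\<^sub>i) m (x + z) - x\<^sub>i m x = x\<^sub>i (m (x + z) - m x) + z\<^sub>i m (x + z)\<close>, which is of lower degree by
  induction.\<close>

lemma monomial_shift_diff:
  "(\<Sum>i\<in>UNIV. \<alpha> i) = Suc q \<Longrightarrow> (\<lambda>x. monomial \<alpha> (x + z) - monomial \<alpha> x) \<in> polys q"
proof (induction q arbitrary: \<alpha>)
  case (0 \<alpha>)
  then have "(\<Sum>i\<in>UNIV. \<alpha> i) \<noteq> 0" by simp
  then obtain i where i: "\<alpha> i > 0" by fastforce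
  define \<beta> where "\<beta> j = (if j = i then \<alpha> j - 1 else \<alpha> j)" for j
  have \<alpha>: "\<alpha> = (\<lambda>j. if j = i then Suc (\<beta> j) else \<beta> j)" using i by (auto simp: \<beta>_def)
  have "(\<Sum>j\<in>UNIV. \<beta> j) = 0" using 0 sum_add_unit[of i \<beta>] unfolding \<alpha> by simp
  then have "\<beta> j = 0" for j by simp
  then have "\<And>x. monomial \<beta> x = 1" by (simp add: monomial_def)
  then show ?case using polys_const[of "z $ i" 0] by (simp add: \<alpha> monomial_add_unit)
next
  case (Suc q \<alpha>)
  then have "(\<Sum>i\<in>UNIV. \<alpha> i) \<noteq> 0" by simp
  then obtain i where i: "\<alpha> i > 0" by fastforce
  define \<beta> where "\<beta> j = (if j = i then \<alpha> j - 1 else \<alpha> j)" for j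
  have \<alpha>: "\<alpha> = (\<lambda>j. if j = i then Suc (\<beta> j) else \<beta> j)" using i by (auto simp: \<beta>_def)
  have s: "(\<Sum>j\<in>UNIV. \<beta> j) = Suc q" using Suc.prems sum_add_unit[of i \<beta>] unfolding \<alpha> by simp
  have IH: "(\<lambda>x. monomial \<beta> (x + z) - monomial \<beta> x) \<in> polys q" by (rule Suc.IH[OF s])
  have \<beta>: "monomial \<beta> \<in> polys (Suc q)" by (rule monomial_in_polys) (simp add: exponents_def s)
  have "(\<lambda>x. monomial \<alpha> (x + z) - monomial \<alpha> x) =
     (\<lambda>x. x $ i * (monomial \<beta> (x + z) - monomial \<beta> x)
        + z $ i * ((monomial \<beta> (x + z) - monomial \<beta> x) + monomial \<beta> x))"
    by (simp add: \<alpha> monomial_add_unit algebra_simps)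
  also have "\<dots> \<in> polys (Suc q)"
    by (intro polys_add[OF polys_coordinate_mult[OF IH]] polys_scale polys_add \<beta>
        polys_mono[OF _ IH]) simp
  finally show ?case .
qed

text \<open>The source of the extra order of accuracy: a translation changes a polynomial of degree
  \<open>q + 1\<close> by one of degree at most \<open>q\<close>, because it preserves the leading terms.\<close>

lemma polys_shift_diff:
  assumes "f \<in> polys (Suc q)" shows "(\<lambda>x. f (x + z) - f x) \<in> polys q"
proof -
  from assms obtain c where f: "f = (\<lambda>x. \<Sum>\<alpha>\<in>exponents (Suc q). c \<alpha> * monomial \<alpha> x)"
    by (auto simp: polys_iff)
  have "(\<lambda>x. monomial \<alpha> (x + z) - monomial \<alpha> x) \<in> polys q" if "\<alpha> \<in> exponents (Suc q)" for \<alpha>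
  proof (cases "\<Sum>i\<in>UNIV. \<alpha> i")
    case 0
    then show ?thesis using polys_const[of 0 q] by (simp add: monomial_def)
  next
    case (Suc r)
    then show ?thesis
      using that by (intro polys_mono[OF _ monomial_shift_diff[OF Suc]]) (simp add: exponents_def)
  qed
  then have "(\<lambda>x. \<Sum>\<alpha>\<in>exponents (Suc q). c \<alpha> * (monomial \<alpha> (x + z) - monomial \<alpha> x)) \<in> polys q"
    by (intro polys_sum polys_scale finite_exponents)
  then show ?thesis by (simp add: f right_diff_distrib sum_subtractf)
qed

lemma polys_shift:
  assumes "f \<in> polys q" shows "(\<lambda>x. f (x + z)) \<in> polys q"
proof -
  have "(\<lambda>x. f (x + z) - f x) \<in> polys q" using polys_shift_diff[OF polys_mono[OF _ assms]] by simp
  from polys_add[OF this assms] show ?thesis by simp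
qed

text \<open>The class of functions for which the divergence theorem is proved below. The gradient is kept as an
  explicit vector field because it is integrated componentwise.\<close>

definition has_continuous_gradient :: "(real^'d \<Rightarrow> real) \<Rightarrow> (real^'d \<Rightarrow> real^'d) \<Rightarrow> bool" where
  "has_continuous_gradient g G \<longleftrightarrow>
     continuous_on UNIV G \<and> (\<forall>x. (g has_derivative (\<lambda>h. G x \<bullet> h)) (at x))"

lemma has_continuous_gradient_continuous:
  "has_continuous_gradient g G \<Longrightarrow> continuous_on X g"
  by (rule continuous_at_imp_continuous_on)
     (auto simp: has_continuous_gradient_def intro: has_derivative_continuous)

lemma has_continuous_gradient_const: "has_continuous_gradient (\<lambda>x. k) (\<lambda>x. 0)"
  by (simp add: has_continuous_gradient_def)

lemma has_continuous_gradient_component: "has_continuous_gradient (\<lambda>x. x $ i) (\<lambda>x. axis i 1)"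
  unfolding has_continuous_gradient_def
  by (auto simp: inner_axis' intro!: has_derivative_eq_rhs[OF bounded_linear_imp_has_derivative])

lemma has_continuous_gradient_add:
  assumes "has_continuous_gradient f F" "has_continuous_gradient g G"
  shows "has_continuous_gradient (\<lambda>x. f x + g x) (\<lambda>x. F x + G x)"
  using assms unfolding has_continuous_gradient_def
  by (auto intro!: continuous_intros has_derivative_eq_rhs[OF has_derivative_add] simp: inner_add_left)

lemma has_continuous_gradient_mult:
  assumes "has_continuous_gradient f F" "has_continuous_gradient g G"
  shows "has_continuous_gradient (\<lambda>x. f x * g x) (\<lambda>x. f x *\<^sub>R G x + g x *\<^sub>R F x)"
  using assms has_continuous_gradient_continuous[OF assms(1)] has_continuous_gradient_continuous[OF assms(2)]
  unfolding has_continuous_gradient_def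
  by (auto intro!: continuous_intros has_derivative_eq_rhs[OF has_derivative_mult]
      simp: inner_add_left algebra_simps)

lemma polys_continuous_gradient:
  assumes "f \<in> polys q" obtains G where "has_continuous_gradient f G"
proof -
  have pow: "\<exists>G. has_continuous_gradient (\<lambda>x. (x $ i) ^ n) G" for i :: 'a and n
  proof (induction n)
    case (Suc n)
    then show ?case
      using has_continuous_gradient_mult[OF has_continuous_gradient_component, of _ _ i] by fastforce
  qed (auto intro: has_continuous_gradient_const)
  have prod: "\<exists>G. has_continuous_gradient (\<lambda>x. \<Prod>i\<in>I. (x $ i) ^ \<alpha> i) G" if "finite I"
    for \<alpha> and I :: "'a set"
    using that
  proof (induction I rule: finite_induct)
    case (insert i I)
    then obtain F G where "has_continuous_gradient (\<lambda>x. (x $ i) ^ \<alpha> i) F"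
        "has_continuous_gradient (\<lambda>x. \<Prod>i\<in>I. (x $ i) ^ \<alpha> i) G" using pow by blast
    from has_continuous_gradient_mult[OF this] show ?case using insert by auto
  qed (auto intro: has_continuous_gradient_const)
  have "\<exists>G. has_continuous_gradient (\<lambda>x. \<Sum>\<alpha>\<in>E. c \<alpha> * monomial \<alpha> x) G" if "finite E"
    for c and E :: "('a \<Rightarrow> nat) set"
    using that
  proof (induction E rule: finite_induct)
    case (insert \<alpha> E)
    then obtain G where G: "has_continuous_gradient (\<lambda>x. \<Sum>\<alpha>\<in>E. c \<alpha> * monomial \<alpha> x) G" by auto
    obtain H where H: "has_continuous_gradient (monomial \<alpha>) H"
      using prod[of UNIV \<alpha>] by (auto simp: monomial_def[abs_def])
    show ?case
      using has_continuous_gradient_add[OF has_continuous_gradient_mult[OF has_continuous_gradient_const H, of "c \<alpha>"] G] insert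
      by auto
  qed (auto intro: has_continuous_gradient_const)
  then show ?thesis using that assms finite_exponents by (auto simp: polys_iff) 
qed

section \<open>Cell averages\<close>

lemma lborel_integral_shift:
  fixes f :: "'a::euclidean_space \<Rightarrow> 'b::{banach, second_countable_topology}"
  assumes "f \<in> borel_measurable borel"
  shows "(LINT x|lborel. f (x + z)) = (LINT x|lborel. f x)"
proof -
  have "(LINT x|lborel. f x) = (LINT x|distr lborel borel ((+) z). f x)"
    by (simp add: lborel_distr_plus)
  also have "\<dots> = (LINT x|lborel. f (z + x))"
    by (rule integral_distr) (use assms in simp_all)
  finally show ?thesis by (simp add: add.commute)
qed

lemma indicator_shift: "indicator ((+) z ` K) (x + z) = indicator K (x :: 'a::ab_group_add)"
  by (auto simp: indicator_def image_iff add.commute)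

lemma compact_set_integrable:
  fixes f :: "'a::euclidean_space \<Rightarrow> 'b::{banach, second_countable_topology}"
  assumes "compact K" "continuous_on UNIV f" shows "set_integrable lborel K f"
  unfolding set_integrable_def
  by (rule borel_integrable_compact[OF assms(1) continuous_on_subset[OF assms(2)]]) simp

lemma compact_set_integral_shift:
  fixes f :: "'a::euclidean_space \<Rightarrow> 'b::{banach, second_countable_topology}"
  assumes "compact K" "continuous_on UNIV f"
  shows "(LINT x:(+) z ` K|lborel. f x) = (LINT x:K|lborel. f (x + z))"
proof -
  have "compact ((+) z ` K)" using assms(1) by (simp add: compact_translation)
  then have "(\<lambda>x. indicator ((+) z ` K) x *\<^sub>R f x) \<in> borel_measurable borel"
    using compact_set_integrable[OF _ assms(2)] by (auto simp: set_integrable_def)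
  from lborel_integral_shift[OF this, of z] show ?thesis
    by (simp add: set_lebesgue_integral_def indicator_shift)
qed

lemma lborel_measure_shift:
  fixes K :: "'a::euclidean_space set"
  assumes "compact K" shows "measure lborel ((+) z ` K) = measure lborel K"
proof -
  have "(LINT x:(+) z ` K|lborel. 1::real) = (LINT x:K|lborel. 1)"
    by (rule compact_set_integral_shift) (use assms in simp_all)
  then show ?thesis by (simp add: set_lebesgue_integral_def)
qed

lemma cell_avg_shift:
  assumes "compact K" "continuous_on UNIV f"
  shows "cell_avg ((+) z ` K) f = cell_avg K (\<lambda>x. f (x + z))"
  by (simp add: cell_avg_def compact_set_integral_shift[OF assms] lborel_measure_shift[OF assms(1)])

lemma cell_avg_add:
  assumes "compact K" "continuous_on UNIV f" "continuous_on UNIV g"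
  shows "cell_avg K (\<lambda>x. f x + g x) = cell_avg K f + cell_avg K g"
  using assms by (simp add: cell_avg_def compact_set_integrable set_integral_add scaleR_add_right)

lemma cell_avg_scale: "cell_avg K (\<lambda>x. k * f x :: real) = k * cell_avg K f"
  by (simp add: cell_avg_def)

lemma cell_avg_diff:
  assumes "compact K" "continuous_on UNIV f" "continuous_on UNIV g"
  shows "cell_avg K (\<lambda>x. f x - g x) = cell_avg K f - cell_avg K g"
  using assms by (simp add: cell_avg_def compact_set_integrable set_integral_diff scaleR_diff_right)

lemma cell_avg_const:
  assumes "compact K" "0 < measure lborel K" shows "cell_avg K (\<lambda>x. k::real) = k"
  using assms emeasure_compact_finite[OF assms(1)]
  by (simp add: cell_avg_def set_lebesgue_integral_def)

lemma polys_continuous: "f \<in> polys q \<Longrightarrow> continuous_on X f"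
  by (meson polys_continuous_gradient has_continuous_gradient_continuous)

section \<open>Constrained least squares\<close>

text \<open>The normal equations of a weighted least-squares problem are solvable even when the columns \<open>a\<close>
  are dependent. A new column is replaced by its residual \<open>r\<close> with respect to the earlier ones;
  the division by zero for \<open>r = 0\<close> gives the coefficient zero, which is then a correct choice.\<close>

lemma normal_equations_solvable:
  fixes a :: "'i \<Rightarrow> 'k \<Rightarrow> real"
  assumes "finite I" "finite K" and w: "\<And>k. k \<in> K \<Longrightarrow> 0 < w k"
  shows "\<exists>c. \<forall>i\<in>I. (\<Sum>k\<in>K. w k * (u k - (\<Sum>j\<in>I. c j * a j k)) * a i k) = 0"
  using assms(1)
proof (induction I arbitrary: u rule: finite_induct)
  case empty
  then show ?case by simp
next
  case (insert b I)
  define ip where "ip x y = (\<Sum>k\<in>K. w k * x k * y k)" for x y :: "'k \<Rightarrow> real"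
  have ip_diff: "ip (\<lambda>k. x k - t * y k) z = ip x z - t * ip y z" for x y z t
    by (simp add: ip_def sum_distrib_left sum_subtractf[symmetric] algebra_simps)
  have ip_lin: "ip x (\<lambda>k. y k + (\<Sum>j\<in>I. d j * a j k)) = ip x y + (\<Sum>j\<in>I. d j * ip x (a j))" for x y d
    unfolding ip_def
    by (simp add: distrib_left sum.distrib sum_distrib_left sum.swap[of _ K] mult_ac)
  obtain c where c: "\<And>i. i \<in> I \<Longrightarrow> ip (\<lambda>k. u k - (\<Sum>j\<in>I. c j * a j k)) (a i) = 0"
    using insert.IH[of u] by (auto simp: ip_def)
  obtain d where d: "\<And>i. i \<in> I \<Longrightarrow> ip (\<lambda>k. a b k - (\<Sum>j\<in>I. d j * a j k)) (a i) = 0"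
    using insert.IH[of "a b"] by (auto simp: ip_def)
  define s where "s = (\<lambda>k. u k - (\<Sum>j\<in>I. c j * a j k))"
  define r where "r = (\<lambda>k. a b k - (\<Sum>j\<in>I. d j * a j k))"
  define t where "t = ip s r / ip r r"
  define e where "e j = (if j = b then t else c j - t * d j)" for j
  have "ip s r = t * ip r r"
  proof (cases "ip r r = 0")
    case True
    then have "\<forall>k\<in>K. w k * r k * r k = 0"
      unfolding ip_def using w \<open>finite K\<close>
      by (subst (asm) sum_nonneg_eq_0_iff) (auto simp: mult.assoc less_imp_le)
    then have "r k = 0" if "k \<in> K" for k using w[OF that] that by auto
    then have "ip s r = 0" by (simp add: ip_def)
    then show ?thesis using True by simp
  qed (simp add: t_def)
  then have r: "ip (\<lambda>k. s k - t * r k) r = 0" by (simp add: ip_diff)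
  have i: "ip (\<lambda>k. s k - t * r k) (a i) = 0" if "i \<in> I" for i
    using c[OF that] d[OF that] by (simp add: ip_diff s_def r_def)
  have b: "ip (\<lambda>k. s k - t * r k) (a b) = 0"
  proof -
    have "a b = (\<lambda>k. r k + (\<Sum>j\<in>I. d j * a j k))" by (simp add: r_def)
    then have "ip (\<lambda>k. s k - t * r k) (a b) = ip (\<lambda>k. s k - t * r k) r
        + (\<Sum>j\<in>I. d j * ip (\<lambda>k. s k - t * r k) (a j))" using ip_lin by metis
    then show ?thesis by (simp add: r i)
  qed
  have "u k - (\<Sum>j\<in>insert b I. e j * a j k) = s k - t * r k" for k
  proof -
    have "(\<Sum>j\<in>insert b I. e j * a j k) = t * a b k + (\<Sum>j\<in>I. (c j - t * d j) * a j k)"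
      using insert.hyps by (simp add: e_def) (rule sum.cong, auto)
    then show ?thesis
      by (simp add: s_def r_def algebra_simps sum_subtractf sum_distrib_left)
  qed
  then show ?case using i b unfolding ip_def by (intro exI[of _ e]) auto
qed

locale stencil =
  fixes p :: nat and S :: "'d::finite stencils" and w :: "'d weights" and T :: "(real^'d) set"
  assumes finite_stencil: "finite (S T)"
    and center: "T \<in> S T"
    and weight_pos: "K \<in> S T \<Longrightarrow> 0 < w T K"
    and cell_compact: "K \<in> S T \<Longrightarrow> compact K"
    and cell_measure_pos: "K \<in> S T \<Longrightarrow> 0 < measure lborel K"
    and unisolvent: "\<lbrakk>q \<in> polys p; \<And>K. K \<in> S T \<Longrightarrow> cell_avg K q = 0\<rbrakk> \<Longrightarrow> q = (\<lambda>x. 0)"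
begin

text \<open>The variational equations of the constrained minimization. Unlike minimality they are linear
  in \<open>(u, q)\<close>, so that translations and additions of polynomials preserve them at sight.\<close>

definition fits :: "((real^'d) set \<Rightarrow> real) \<Rightarrow> (real^'d \<Rightarrow> real) \<Rightarrow> bool" where
  "fits u q \<longleftrightarrow> q \<in> polys p \<and> cell_avg T q = u T \<and>
     (\<forall>h\<in>polys p. cell_avg T h = 0 \<longrightarrow> (\<Sum>K\<in>S T. w T K * (u K - cell_avg K q) * cell_avg K h) = 0)"

text \<open>Pythagoras: by the variational equations the objective at \<open>q'\<close> exceeds that at \<open>q\<close> by the weighted
  sum of squares of the cell averages of \<open>q - q'\<close>, which by unisolvence vanishes for \<open>q' = q\<close> alone.\<close>

lemma fits_unique_minimizer:
  assumes q: "fits u q" and q': "q' \<in> polys p" "cell_avg T q' = u T"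
    and le: "(\<Sum>K\<in>S T. w T K * (u K - cell_avg K q')\<^sup>2) \<le> (\<Sum>K\<in>S T. w T K * (u K - cell_avg K q)\<^sup>2)"
  shows "q' = q"
proof -
  define h where "h = (\<lambda>x. q x - q' x)"
  have h: "h \<in> polys p" using q q' by (auto simp: h_def fits_def intro: polys_diff)
  have hK: "cell_avg K h = cell_avg K q - cell_avg K q'" if "K \<in> S T" for K
    using q q' unfolding h_def
    by (intro cell_avg_diff cell_compact that) (auto simp: fits_def intro: polys_continuous)
  have "(\<Sum>K\<in>S T. w T K * (u K - cell_avg K q) * cell_avg K h) = 0"
    using q q'(2) h hK[OF center] by (auto simp: fits_def)
  moreover have "(\<Sum>K\<in>S T. w T K * (u K - cell_avg K q')\<^sup>2) =
      (\<Sum>K\<in>S T. w T K * (u K - cell_avg K q)\<^sup>2) + (\<Sum>K\<in>S T. w T K * (cell_avg K h)\<^sup>2)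
      + 2 * (\<Sum>K\<in>S T. w T K * (u K - cell_avg K q) * cell_avg K h)"
    unfolding sum_distrib_left sum.distrib[symmetric]
    by (rule sum.cong) (auto simp: hK power2_eq_square algebra_simps)
  ultimately have "(\<Sum>K\<in>S T. w T K * (cell_avg K h)\<^sup>2) \<le> 0" using le by simp
  moreover have "0 \<le> w T K * (cell_avg K h)\<^sup>2" if "K \<in> S T" for K
    using weight_pos[OF that] by simp
  ultimately have "\<forall>K\<in>S T. w T K * (cell_avg K h)\<^sup>2 = 0"
    using sum_nonneg_eq_0_iff[OF finite_stencil, of "\<lambda>K. w T K * (cell_avg K h)\<^sup>2"]
    by (meson antisym sum_nonneg)
  then have "cell_avg K h = 0" if "K \<in> S T" for K using weight_pos[OF that] that by auto
  then have "h = (\<lambda>x. 0)" using unisolvent[OF h] by blast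
  then show ?thesis by (auto simp: h_def fun_eq_iff)
qed

lemma reconstruction_eqI:
  assumes "fits u q" shows "reconstruction p S w T u = q"
proof -
  let ?f = "\<lambda>q. \<Sum>K\<in>S T. w T K * (u K - cell_avg K q)\<^sup>2"
  let ?P = "\<lambda>q. q \<in> polys p \<and> cell_avg T q = u T"
  have P: "?P q" using assms by (simp add: fits_def)
  have "is_arg_min ?f ?P q" unfolding is_arg_min_def
  proof (intro conjI notI)
    assume "\<exists>q'. ?P q' \<and> ?f q' < ?f q"
    then obtain q' where q': "?P q'" "?f q' < ?f q" by blast
    then have "q' = q" using fits_unique_minimizer[OF assms, of q'] by simp
    then show False using q'(2) by simp
  qed (use P in simp_all)
  moreover have "q' = q" if "is_arg_min ?f ?P q'" for q'
  proof (rule fits_unique_minimizer[OF assms])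
    show "?f q' \<le> ?f q" using that P unfolding is_arg_min_def by (meson not_le)
  qed (use that in \<open>auto simp: is_arg_min_def\<close>)
  ultimately show ?thesis unfolding reconstruction_def arg_min_def by blast
qed

text \<open>Written as the constant \<open>u T\<close> plus combinations of the monomials minus their mean over \<open>T\<close>, a
  polynomial meets the constraint automatically, and an unconstrained least-squares problem remains.\<close>

lemma fits_ex: "\<exists>q. fits u q"
proof -
  define a where "a \<alpha> K = cell_avg K (monomial \<alpha>) - cell_avg T (monomial \<alpha>)" for \<alpha> :: "'d \<Rightarrow> nat" and K
  define comb where "comb d = (\<lambda>x. \<Sum>\<alpha>\<in>exponents p. d \<alpha> * (monomial \<alpha> x - cell_avg T (monomial \<alpha>)))"
    for d :: "('d \<Rightarrow> nat) \<Rightarrow> real"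
  have mono_cont: "continuous_on UNIV (monomial \<alpha>)" for \<alpha> :: "'d \<Rightarrow> nat"
    by (rule polys_continuous[OF monomial_in_polys[of _ "\<Sum>i\<in>UNIV. \<alpha> i"]]) (simp add: exponents_def)
  have avg: "cell_avg K (\<lambda>x. \<Sum>\<alpha>\<in>E. d \<alpha> * (monomial \<alpha> x - cell_avg T (monomial \<alpha>))) = (\<Sum>\<alpha>\<in>E. d \<alpha> * a \<alpha> K)"
    if "finite E" "K \<in> S T" for d E K
    using that(1)
  proof (induction E rule: finite_induct)
    case empty
    show ?case using cell_avg_const[OF cell_compact cell_measure_pos, of K 0] that by simp
  next
    case (insert \<alpha> E)
    have "cell_avg K (\<lambda>x. d \<alpha> * (monomial \<alpha> x - cell_avg T (monomial \<alpha>))) = d \<alpha> * a \<alpha> K"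
      using that cell_compact cell_measure_pos mono_cont
      by (simp add: cell_avg_scale cell_avg_diff cell_avg_const a_def)
    then show ?case using insert that cell_compact mono_cont
      by (simp add: cell_avg_add continuous_intros)
  qed
  have comb_polys: "comb d \<in> polys p" for d unfolding comb_def
    by (intro polys_sum polys_scale polys_diff monomial_in_polys polys_const finite_exponents)
  have comb_avg: "cell_avg K (comb d) = (\<Sum>\<alpha>\<in>exponents p. d \<alpha> * a \<alpha> K)" if "K \<in> S T" for d K
    unfolding comb_def by (rule avg[OF finite_exponents that])
  obtain c where c: "\<And>\<alpha>. \<alpha> \<in> exponents p \<Longrightarrow>
      (\<Sum>K\<in>S T. w T K * ((u K - u T) - (\<Sum>\<beta>\<in>exponents p. c \<beta> * a \<beta> K)) * a \<alpha> K) = 0"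
    using normal_equations_solvable[where u = "\<lambda>K. u K - u T" and w = "w T" and a = a, OF finite_exponents[of p] finite_stencil weight_pos]
    by blast
  define q where "q = (\<lambda>x. u T + comb c x)"
  have q: "q \<in> polys p" unfolding q_def by (intro polys_add polys_const comb_polys)
  have q_avg: "cell_avg K q = u T + (\<Sum>\<alpha>\<in>exponents p. c \<alpha> * a \<alpha> K)" if "K \<in> S T" for K
    unfolding q_def
    using cell_avg_add[OF cell_compact[OF that] continuous_on_const polys_continuous[OF comb_polys]]
      cell_avg_const[OF cell_compact cell_measure_pos] comb_avg that
    by simp
  have "(\<Sum>K\<in>S T. w T K * (u K - cell_avg K q) * cell_avg K h) = 0"
    if h: "h \<in> polys p" "cell_avg T h = 0" for h
  proof -
    obtain d where d: "h = (\<lambda>x. \<Sum>\<alpha>\<in>exponents p. d \<alpha> * monomial \<alpha> x)" using h by (auto simp: polys_iff)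
    define k where "k = (\<Sum>\<alpha>\<in>exponents p. d \<alpha> * cell_avg T (monomial \<alpha>))"
    have hd: "h = (\<lambda>x. comb d x + k)"
      by (simp add: d comb_def k_def right_diff_distrib sum_subtractf)
    have "cell_avg K h = cell_avg K (comb d) + k" if "K \<in> S T" for K
      unfolding hd using that cell_compact cell_measure_pos
      by (simp add: cell_avg_add cell_avg_const polys_continuous[OF comb_polys])
    moreover from this[OF center] have "k = 0"
      using h(2) comb_avg[OF center] by (simp add: a_def)
    ultimately have "cell_avg K h = (\<Sum>\<alpha>\<in>exponents p. d \<alpha> * a \<alpha> K)" if "K \<in> S T" for K
      using that comb_avg by simp
    moreover have pull_out: "r * (\<Sum>\<alpha>\<in>exponents p. d \<alpha> * a \<alpha> K) = (\<Sum>\<alpha>\<in>exponents p. d \<alpha> * (r * a \<alpha> K))"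
      for r K by (simp add: sum_distrib_left mult_ac)
    ultimately have "(\<Sum>K\<in>S T. w T K * (u K - cell_avg K q) * cell_avg K h)
        = (\<Sum>K\<in>S T. \<Sum>\<alpha>\<in>exponents p. d \<alpha> *
            (w T K * ((u K - u T) - (\<Sum>\<beta>\<in>exponents p. c \<beta> * a \<beta> K)) * a \<alpha> K))"
      using pull_out by (intro sum.cong refl) (simp only: q_avg diff_diff_eq)
    also have "\<dots> = (\<Sum>\<alpha>\<in>exponents p. d \<alpha> *
        (\<Sum>K\<in>S T. w T K * ((u K - u T) - (\<Sum>\<beta>\<in>exponents p. c \<beta> * a \<beta> K)) * a \<alpha> K))"
      by (subst sum.swap) (simp add: sum_distrib_left)
    also have "\<dots> = 0" by (simp add: c)
    finally show ?thesis .
  qed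
  then have "fits u q" using q q_avg[OF center] by (auto simp: fits_def a_def)
  then show ?thesis by blast
qed

lemma fits_reconstruction: "fits u (reconstruction p S w T u)"
  using fits_ex[of u] reconstruction_eqI by metis

lemma reconstruction_in_polys: "reconstruction p S w T u \<in> polys p"
  using fits_reconstruction[of u] by (simp add: fits_def)

lemma reconstruction_cong:
  assumes "\<And>K. K \<in> S T \<Longrightarrow> u K = v K"
  shows "reconstruction p S w T u = reconstruction p S w T v"
proof (rule reconstruction_eqI)
  have "(\<Sum>K\<in>S T. w T K * (u K - x K) * y K) = (\<Sum>K\<in>S T. w T K * (v K - x K) * y K)" for x y
    by (rule sum.cong) (simp_all add: assms)
  then show "fits u (reconstruction p S w T v)"
    using fits_reconstruction[of v] assms[OF center] unfolding fits_def by simp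
qed

lemma reconstruction_add_polys:
  assumes g: "g \<in> polys p"
  shows "reconstruction p S w T (\<lambda>K. u K + cell_avg K g) = (\<lambda>x. reconstruction p S w T u x + g x)"
proof (rule reconstruction_eqI)
  define q where "q = reconstruction p S w T u"
  have f: "fits u q" unfolding q_def by (rule fits_reconstruction)
  have avg: "cell_avg K (\<lambda>x. q x + g x) = cell_avg K q + cell_avg K g" if "K \<in> S T" for K
    using f g that by (intro cell_avg_add cell_compact) (auto simp: fits_def intro: polys_continuous)
  have "(\<Sum>K\<in>S T. w T K * (u K + cell_avg K g - cell_avg K (\<lambda>x. q x + g x)) * cell_avg K h)
      = (\<Sum>K\<in>S T. w T K * (u K - cell_avg K q) * cell_avg K h)" for h
    by (rule sum.cong) (simp_all add: avg)
  then show "fits (\<lambda>K. u K + cell_avg K g) (\<lambda>x. q x + g x)"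
    using f g avg[OF center] by (auto simp: fits_def intro: polys_add)
qed

text \<open>The variational equations on \<open>z + T\<close> are those on \<open>T\<close> with all functions shifted by \<open>z\<close>.\<close>

lemma reconstruction_shift:
  assumes S: "S ((+) z ` T) = (\<lambda>K. (+) z ` K) ` S T"
    and w: "\<And>K. K \<in> S T \<Longrightarrow> w ((+) z ` T) ((+) z ` K) = w T K"
  shows "reconstruction p S w ((+) z ` T) u
       = (\<lambda>x. reconstruction p S w T (\<lambda>K. u ((+) z ` K)) (x - z))"
proof -
  have inj: "inj_on (\<lambda>K. (+) z ` K) X" for X :: "(real^'d) set set"
    by (rule inj_on_subset[of _ UNIV]) (auto simp: inj_image_eq_iff intro!: injI)
  have shift_back: "cell_avg K (\<lambda>x. h (x - z)) = cell_avg K' h"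
    if "K' \<in> S T" "K = (+) z ` K'" "h \<in> polys p" for h K K'
    using cell_avg_shift[OF cell_compact[OF that(1)], of "\<lambda>x. h (x - z)" z] that(2)
      polys_continuous[OF polys_shift[OF that(3), of "- z"]] by simp
  have shift_fwd: "cell_avg ((+) z ` K) h = cell_avg K (\<lambda>x. h (x + z))"
    if "K \<in> S T" "h \<in> polys p" for h K
    by (rule cell_avg_shift[OF cell_compact[OF that(1)] polys_continuous[OF that(2)]])
  interpret z: stencil p S w "(+) z ` T"
  proof
    fix K assume "K \<in> S ((+) z ` T)"
    then obtain K' where K': "K' \<in> S T" "K = (+) z ` K'" by (auto simp: S)
    show "0 < w ((+) z ` T) K" using K' w weight_pos by simp
    show "compact K" using K' cell_compact by (simp add: compact_translation)
    show "0 < measure lborel K" using K' cell_compact cell_measure_pos by (simp add: lborel_measure_shift)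
  next
    fix q assume q: "q \<in> polys p" "\<And>K. K \<in> S ((+) z ` T) \<Longrightarrow> cell_avg K q = 0"
    have "(\<lambda>x. q (x + z)) = (\<lambda>x. 0)"
    proof (intro unisolvent polys_shift q(1))
      fix K assume K: "K \<in> S T"
      then have "cell_avg ((+) z ` K) q = 0" by (intro q(2)) (simp add: S)
      then show "cell_avg K (\<lambda>x. q (x + z)) = 0" using shift_fwd[OF K q(1)] by simp
    qed
    then have "q (x - z + z) = 0" for x by metis
    then show "q = (\<lambda>x. 0)" by auto
  qed (use finite_stencil center S in auto)
  define q where "q = reconstruction p S w T (\<lambda>K. u ((+) z ` K))"
  have f: "fits (\<lambda>K. u ((+) z ` K)) q" unfolding q_def by (rule fits_reconstruction)
  have q: "q \<in> polys p" using f by (simp add: fits_def)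
  have "z.fits u (\<lambda>x. q (x - z))" unfolding z.fits_def
  proof (intro conjI ballI impI)
    show "(\<lambda>x. q (x - z)) \<in> polys p" using polys_shift[OF q, of "- z"] by simp
    show "cell_avg ((+) z ` T) (\<lambda>x. q (x - z)) = u ((+) z ` T)"
      using shift_back[OF center refl q] f by (simp add: fits_def)
    fix h assume h: "h \<in> polys p" "cell_avg ((+) z ` T) h = 0"
    have "(\<Sum>K\<in>S ((+) z ` T). w ((+) z ` T) K * (u K - cell_avg K (\<lambda>x. q (x - z))) * cell_avg K h)
        = (\<Sum>K\<in>S T. w T K * (u ((+) z ` K) - cell_avg K q) * cell_avg K (\<lambda>x. h (x + z)))"
      unfolding S by (subst sum.reindex[OF inj])
        (auto intro!: sum.cong simp: w shift_back[OF _ refl q] shift_fwd[OF _ h(1)])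
    also have "\<dots> = 0"
      using f h shift_fwd[OF center h(1)] polys_shift[OF h(1), of z] by (auto simp: fits_def)
    finally show "(\<Sum>K\<in>S ((+) z ` T). w ((+) z ` T) K * (u K - cell_avg K (\<lambda>x. q (x - z))) * cell_avg K h) = 0" .
  qed
  then show ?thesis unfolding q_def[symmetric] by (rule z.reconstruction_eqI)
qed

end

section \<open>Integration along a family of parallel lines\<close>

text \<open>A \<open>\<tau>\<close> with \<open>\<tau> (x + s e) = \<tau> x + s\<close> is a coordinate along the lines of direction \<open>e\<close>, and the slab
  \<open>0 \<le> \<tau> \<le> 1\<close> serves as the space of these lines. Since the \<open>s\<close> with \<open>0 \<le> \<tau> x - s \<le> 1\<close> have measure 1,
  the identity follows by inserting their integral, exchanging the integrals, and translating
  \<open>x\<close> by \<open>s e\<close>; no change of coordinates is involved.\<close>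

lemma integral_by_parallel_lines:
  fixes h :: "'a::euclidean_space \<Rightarrow> real"
  assumes h: "integrable lborel h"
    and [measurable]: "\<tau> \<in> borel_measurable borel"
    and \<tau>: "\<And>x s. \<tau> (x + s *\<^sub>R e) = \<tau> x + s"
  shows "(LINT x|lborel. h x) = (LINT x|lborel. indicator {0..1} (\<tau> x) * (LINT s|lborel. h (x + s *\<^sub>R e)))"
proof -
  have [measurable]: "h \<in> borel_measurable borel" using h by auto
  define k where "k x s = h x * indicator {0..1} (\<tau> x - s)" for x and s :: real
  define k' where "k' x s = h (x + s *\<^sub>R e) * indicator {0..1} (\<tau> x)" for x and s :: real
  have [measurable]: "case_prod k \<in> borel_measurable (lborel \<Otimes>\<^sub>M lborel)"
    "case_prod (\<lambda>s x. k' x s) \<in> borel_measurable (lborel \<Otimes>\<^sub>M lborel)"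
    "case_prod k' \<in> borel_measurable (lborel \<Otimes>\<^sub>M lborel)"
    unfolding k_def k'_def by measurable
  have "(\<lambda>s. indicator {0..1} (\<tau> x - s)) = (indicator {\<tau> x - 1..\<tau> x} :: real \<Rightarrow> real)" for x
    by (auto simp: indicator_def fun_eq_iff)
  then have slab: "integrable lborel (\<lambda>s. indicator {0..1} (\<tau> x - s) :: real)"
    "(LINT s|lborel. indicator {0..1} (\<tau> x - s) :: real) = 1" for x
    by simp_all
  have k_int: "integrable lborel (k x)" and k_eq: "(LINT s|lborel. k x s) = h x"
    and k_norm: "(LINT s|lborel. norm (k x s)) = norm (h x)" for x
    by (simp_all add: k_def[abs_def] abs_mult slab)
  have k_prod: "integrable (lborel \<Otimes>\<^sub>M lborel) (case_prod k)"
    by (rule lborel_pair.Fubini_integrable) (use h in \<open>simp_all add: k_int k_norm[simplified]\<close>)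
  have shift: "(LINT x|lborel. F (k' x s)) = (LINT x|lborel. F (k x s))"
    if [measurable]: "F \<in> borel_measurable borel" for F :: "real \<Rightarrow> real" and s
  proof -
    have [measurable]: "(\<lambda>x. k x s) \<in> borel_measurable borel" unfolding k_def by measurable
    have "(LINT x|lborel. F (k x s)) = (LINT x|distr lborel borel ((+) (s *\<^sub>R e)). F (k x s))"
      by (simp add: lborel_distr_plus)
    also have "\<dots> = (LINT x|lborel. F (k (s *\<^sub>R e + x) s))"
      by (rule integral_distr) simp_all
    finally show ?thesis by (simp add: k_def k'_def \<tau> add.commute)
  qed
  have k'_slice: "integrable lborel (\<lambda>x. k' x s) \<longleftrightarrow> integrable lborel (\<lambda>x. k x s)" for s
  proof -
    have [measurable]: "(\<lambda>x. k x s) \<in> borel_measurable borel" unfolding k_def by measurable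
    have "integrable lborel (\<lambda>x. k x s) \<longleftrightarrow> integrable (distr lborel borel ((+) (s *\<^sub>R e))) (\<lambda>x. k x s)"
      by (simp add: lborel_distr_plus)
    also have "\<dots> \<longleftrightarrow> integrable lborel (\<lambda>x. k (s *\<^sub>R e + x) s)"
      by (rule integrable_distr_eq) simp_all
    finally show ?thesis by (simp add: k_def k'_def \<tau> add.commute)
  qed
  have k_swap: "integrable (lborel \<Otimes>\<^sub>M lborel) (\<lambda>(s, x). k x s)"
    using lborel_pair.integrable_product_swap[OF k_prod] by simp
  have "integrable (lborel \<Otimes>\<^sub>M lborel) (\<lambda>(s, x). k' x s)"
  proof (rule lborel_pair.Fubini_integrable)
    show "integrable lborel (\<lambda>s. LINT x|lborel. norm (case (s, x) of (s, x) \<Rightarrow> k' x s))"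
      using lborel_pair.integrable_fst'[OF integrable_norm[OF k_swap]] by (simp add: shift)
    show "AE s in lborel. integrable lborel (\<lambda>x. case (s, x) of (s, x) \<Rightarrow> k' x s)"
      using lborel_pair.AE_integrable_fst'[OF k_swap] by (simp add: k'_slice)
  qed simp
  from lborel_pair.integrable_product_swap[OF this]
  have k'_prod: "integrable (lborel \<Otimes>\<^sub>M lborel) (case_prod k')" by simp
  have "(LINT x|lborel. h x) = (LINT x|lborel. LINT s|lborel. k x s)" by (simp add: k_eq)
  also have "\<dots> = (LINT s|lborel. LINT x|lborel. k x s)"
    using lborel_pair.Fubini_integral[OF k_prod] by simp
  also have "\<dots> = (LINT s|lborel. LINT x|lborel. k' x s)" using shift[of "\<lambda>t. t"] by simp
  also have "\<dots> = (LINT x|lborel. LINT s|lborel. k' x s)"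
    using lborel_pair.Fubini_integral[OF k'_prod] by simp
  finally show ?thesis by (simp add: k'_def mult.commute)
qed

text \<open>On every line of direction \<open>w\<close> the shear is a translation, so it preserves the inner integral.\<close>

lemma integral_shear:
  fixes h :: "'a::euclidean_space \<Rightarrow> real"
  assumes h: "integrable lborel h" and h': "integrable lborel (\<lambda>x. h (x + \<phi> x *\<^sub>R w))"
    and \<phi>: "\<And>x s. \<phi> (x + s *\<^sub>R w) = \<phi> x"
  shows "(LINT x|lborel. h (x + \<phi> x *\<^sub>R w)) = (LINT x|lborel. h x)"
proof (cases "w = 0")
  case False
  define \<tau> where "\<tau> x = (w \<bullet> x) / (w \<bullet> w)" for x
  have [measurable]: "\<tau> \<in> borel_measurable borel" unfolding \<tau>_def by measurable
  have \<tau>: "\<tau> (x + s *\<^sub>R w) = \<tau> x + s" for x s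
    using False by (simp add: \<tau>_def inner_add_right add_divide_distrib)
  have "(LINT s|lborel. h (x + s *\<^sub>R w + \<phi> (x + s *\<^sub>R w) *\<^sub>R w)) = (LINT s|lborel. h (x + s *\<^sub>R w))" for x
    using lborel_integral_real_affine[of 1 "\<lambda>s. h (x + s *\<^sub>R w)" "\<phi> x"]
    by (simp add: \<phi> scaleR_add_left algebra_simps)
  then show ?thesis
    by (simp add: integral_by_parallel_lines[OF h _ \<tau>] integral_by_parallel_lines[OF h' _ \<tau>])
qed simp

text \<open>For a function that is constant on the lines, only the measure of the slab matters.\<close>

lemma integral_slab:
  fixes H :: "'a::euclidean_space \<Rightarrow> real"
  assumes int: "integrable lborel (\<lambda>x. indicator A (\<tau> x) * H x)"
    and [measurable]: "\<tau> \<in> borel_measurable borel" and A: "A \<in> sets borel"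
    and \<tau>: "\<And>x s. \<tau> (x + s *\<^sub>R e) = \<tau> x + s" and H: "\<And>x s. H (x + s *\<^sub>R e) = H x"
  shows "(LINT x|lborel. indicator A (\<tau> x) * H x) = measure lborel A * (LINT x|lborel. indicator {0..1} (\<tau> x) * H x)"
proof -
  have "(LINT s|lborel. indicat_real A (\<tau> x + s)) = measure lborel A" for x
    using lborel_integral_real_affine[of 1 "indicat_real A" "\<tau> x"] by simp
  then have pull: "indicator {0..1} (\<tau> x) * (LINT s|lborel. indicator A (\<tau> (x + s *\<^sub>R e)) * H (x + s *\<^sub>R e))
      = measure lborel A * (indicator {0..1} (\<tau> x) * H x)" for x
    by (simp add: \<tau> H)
  show ?thesis
    by (subst integral_by_parallel_lines[OF int _ \<tau>], simp) (simp only: pull integral_mult_right_zero)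
qed

lemma compact_prism:
  fixes F :: "'a::euclidean_space set" and A :: "real set"
  assumes "compact F" "compact A" "continuous_on UNIV \<tau>"
  shows "compact {x. \<tau> x \<in> A \<and> x - \<tau> x *\<^sub>R u \<in> F}"
proof -
  let ?P = "{x. \<tau> x \<in> A \<and> x - \<tau> x *\<^sub>R u \<in> F}"
  have "compact ((\<lambda>(y, t). y + t *\<^sub>R u) ` (F \<times> A))"
    using assms by (intro compact_continuous_image compact_Times)
      (auto simp: case_prod_unfold intro!: continuous_intros)
  moreover have "?P \<subseteq> (\<lambda>(y, t). y + t *\<^sub>R u) ` (F \<times> A)"
  proof
    fix x assume "x \<in> ?P"
    then show "x \<in> (\<lambda>(y, t). y + t *\<^sub>R u) ` (F \<times> A)"
      by (intro image_eqI[of _ _ "(x - \<tau> x *\<^sub>R u, \<tau> x)"]) auto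
  qed
  ultimately have "bounded ?P" by (meson bounded_subset compact_imp_bounded)
  moreover have "closed ?P"
  proof -
    have "closed ((\<tau> -` A) \<inter> ((\<lambda>x. x - \<tau> x *\<^sub>R u) -` F))"
      using assms by (intro closed_Int closed_vimage continuous_intros) (auto simp: compact_imp_closed)
    then show ?thesis by (simp add: vimage_def Collect_conj_eq)
  qed
  ultimately show ?thesis by (simp add: compact_eq_bounded_closed)
qed

lemma integrable_on_prism:
  fixes k :: "'a::euclidean_space \<Rightarrow> real"
  assumes "compact F" "compact A" "continuous_on UNIV \<tau>" "continuous_on UNIV k"
  shows "integrable lborel (\<lambda>x. indicator A (\<tau> x) * (indicator F (x - \<tau> x *\<^sub>R u) * k x))"
proof -
  have "integrable lborel (\<lambda>x. indicator {x. \<tau> x \<in> A \<and> x - \<tau> x *\<^sub>R u \<in> F} x *\<^sub>R k x)"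
    by (rule borel_integrable_compact[OF compact_prism[OF assms(1-3)] continuous_on_subset[OF assms(4)]]) simp
  then show ?thesis by (rule back_subst[of "integrable lborel"]) (auto simp: indicator_def)
qed

section \<open>Surface integrals over a facet\<close>

lemma integral_hyperplane_measure:
  fixes g :: "real^'d \<Rightarrow> real"
  assumes F: "F \<in> sets borel" and [measurable]: "g \<in> borel_measurable borel"
  shows "(LINT x:F|hyperplane_measure \<nu> c. g x) = (LINT x|lborel. indicator {0..1} (\<nu> \<bullet> x - c) *
      (indicator F (x - (\<nu> \<bullet> x - c) *\<^sub>R \<nu>) * g (x - (\<nu> \<bullet> x - c) *\<^sub>R \<nu>)))"
proof -
  let ?\<Omega> = "{x. c \<le> \<nu> \<bullet> x \<and> \<nu> \<bullet> x \<le> c + 1}" and ?\<pi> = "\<lambda>x. x - (\<nu> \<bullet> x - c) *\<^sub>R \<nu>"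
  note [measurable] = F
  have [measurable]: "?\<pi> \<in> restrict_space lborel ?\<Omega> \<rightarrow>\<^sub>M borel"
    by (rule measurable_restrict_space1) measurable
  have "(LINT x:F|hyperplane_measure \<nu> c. g x)
      = (LINT x|restrict_space lborel ?\<Omega>. indicator F (?\<pi> x) *\<^sub>R g (?\<pi> x))"
    unfolding set_lebesgue_integral_def hyperplane_measure_def by (rule integral_distr) measurable
  also have "\<dots> = (LINT x|lborel. indicator ?\<Omega> x *\<^sub>R (indicator F (?\<pi> x) *\<^sub>R g (?\<pi> x)))"
    by (rule integral_restrict_space) simp
  finally show ?thesis
    by (rule trans) (intro Bochner_Integration.integral_cong refl, auto simp: indicator_def)
qed

text \<open>The prism of height one over \<open>F\<close> that defines the surface measure is orthogonal. A shear along the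
  hyperplane tilts it into direction \<open>e\<close>, and rescaling along \<open>e\<close> gives the factor \<open>\<bar>\<nu> \<bullet> e\<bar>\<close>.\<close>

lemma integral_hyperplane_measure_oblique:
  fixes g :: "real^'d \<Rightarrow> real"
  assumes F: "compact F" and g: "continuous_on UNIV g" and e: "\<nu> \<bullet> e \<noteq> 0" and \<nu>: "norm \<nu> = 1"
    and \<tau>: "\<And>x. \<nu> \<bullet> x - c = (\<nu> \<bullet> e) * \<tau> x"
  shows "(LINT x:F|hyperplane_measure \<nu> c. g x) * \<bar>\<nu> \<bullet> e\<bar> = (LINT x|lborel. indicator {0..1} (\<tau> x) *
      (indicator F (x - \<tau> x *\<^sub>R e) * g (x - \<tau> x *\<^sub>R e)))"
proof -
  define \<kappa> where "\<kappa> = \<nu> \<bullet> e"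
  have \<kappa>: "\<kappa> \<noteq> 0" using e by (simp add: \<kappa>_def)
  have \<tau>_eq: "\<tau> = (\<lambda>x. (\<nu> \<bullet> x - c) / \<kappa>)" using \<tau> e by (auto simp: \<kappa>_def)
  have \<tau>_cont: "continuous_on UNIV \<tau>" unfolding \<tau>_eq by (auto intro!: continuous_intros simp: \<kappa>)
  have [measurable]: "\<tau> \<in> borel_measurable borel" unfolding \<tau>_eq by measurable
  have \<tau>_e: "\<tau> (x + s *\<^sub>R e) = \<tau> x + s" for x s
    using \<kappa> by (simp add: \<tau>_eq \<kappa>_def[symmetric] inner_add_right field_simps)
  have "\<nu> \<bullet> \<nu> = 1" using \<nu> by (simp add: norm_eq_1)
  \<comment> \<open>Adding \<open>\<phi> x\<close> times \<open>w\<close> replaces the height vector \<open>\<phi> x *\<^sub>R \<nu>\<close> of \<open>x\<close> above the hyperplane by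
    \<open>\<phi> x *\<^sub>R (e /\<^sub>R \<kappa>)\<close>; the factor makes \<open>w\<close> parallel to the hyperplane.\<close>
  define w where "w = e /\<^sub>R \<kappa> - \<nu>"
  define \<phi> where "\<phi> x = \<nu> \<bullet> x - c" for x
  have \<phi>: "\<phi> (x + s *\<^sub>R w) = \<phi> x" for x s
    using \<open>\<nu> \<bullet> \<nu> = 1\<close> \<kappa> by (simp add: \<phi>_def w_def inner_add_right inner_diff_right \<kappa>_def[symmetric])
  have \<phi>_\<tau>: "\<phi> x = \<kappa> * \<tau> x" for x using \<tau> by (simp add: \<phi>_def \<kappa>_def)
  define A where "A = {t. \<kappa> * t \<in> {0..1}}"
  have A_eq: "A = (if \<kappa> > 0 then {0..1/\<kappa>} else {1/\<kappa>..0})"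
    using \<kappa> by (auto simp: A_def field_simps mult_le_0_iff zero_le_mult_iff)
  have A: "compact A" "measure lborel A = 1 / \<bar>\<kappa>\<bar>" using \<kappa> by (auto simp: A_eq)
  define H where "H y = indicator F y * g y" for y
  define h where "h x = indicator A (\<tau> x) * H (x - \<tau> x *\<^sub>R e)" for x
  have h_int: "integrable lborel h" unfolding h_def H_def
    by (rule integrable_on_prism[OF F A(1) \<tau>_cont])
       (intro continuous_on_compose2[OF g] continuous_intros \<tau>_cont, auto)
  have shear: "h (x + \<phi> x *\<^sub>R w) = indicator {0..1} (\<nu> \<bullet> x - c) *
      (indicator F (x - (\<nu> \<bullet> x - c) *\<^sub>R \<nu>) * g (x - (\<nu> \<bullet> x - c) *\<^sub>R \<nu>))" for x
  proof -
    have t: "\<tau> (x + \<phi> x *\<^sub>R w) = \<phi> x / \<kappa>"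
      using \<phi>[of x "\<phi> x"] \<phi>_\<tau>[of "x + \<phi> x *\<^sub>R w"] \<kappa> by (simp add: field_simps)
    have p: "x + \<phi> x *\<^sub>R w - (\<phi> x / \<kappa>) *\<^sub>R e = x - \<phi> x *\<^sub>R \<nu>"
      by (simp add: w_def algebra_simps divide_inverse)
    have "indicator A (\<phi> x / \<kappa>) = (indicator {0..1} (\<phi> x) :: real)"
      using \<kappa> by (simp add: A_def indicator_def)
    then show ?thesis by (simp add: h_def t p H_def) (simp add: \<phi>_def)
  qed
  have "continuous_on UNIV (\<lambda>x. g (x - (\<nu> \<bullet> x - c) *\<^sub>R \<nu>))"
    by (rule continuous_on_compose2[OF g]) (auto intro!: continuous_intros)
  then have "integrable lborel (\<lambda>x. h (x + \<phi> x *\<^sub>R w))" unfolding shear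
    by (intro integrable_on_prism[OF F]) (auto intro!: continuous_intros)
  from integral_shear[OF h_int this \<phi>]
  have "(LINT x:F|hyperplane_measure \<nu> c. g x) = (LINT x|lborel. h x)"
    using F g by (subst integral_hyperplane_measure)
      (auto simp: shear borel_compact intro: borel_measurable_continuous_onI)
  also have "\<dots> = measure lborel A * (LINT x|lborel. indicator {0..1} (\<tau> x) * H (x - \<tau> x *\<^sub>R e))"
    unfolding h_def
  proof (rule integral_slab[OF _ _ _ \<tau>_e])
    show "integrable lborel (\<lambda>x. indicator A (\<tau> x) * H (x - \<tau> x *\<^sub>R e))"
      using h_int by (simp add: h_def[abs_def])
    show "H (x + s *\<^sub>R e - \<tau> (x + s *\<^sub>R e) *\<^sub>R e) = H (x - \<tau> x *\<^sub>R e)" for x s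
      by (simp add: \<tau>_e algebra_simps)
  qed (use A(1) in \<open>auto simp: borel_compact\<close>)
  finally show ?thesis using \<kappa> by (simp add: A(2) H_def \<kappa>_def[symmetric])
qed

section \<open>Barycentric coordinates\<close>

text \<open>The barycentric coordinates of the simplex with vertices \<open>C\<close>, as affine functions on the whole
  space. Their gradients \<open>\<alpha> v\<close> are the inner normals of the facets, up to length.\<close>

locale barycentric =
  fixes C :: "(real^'d) set" and \<alpha> :: "real^'d \<Rightarrow> real^'d" and \<beta> :: "real^'d \<Rightarrow> real"
  assumes finite_C: "finite C" and card_C: "card C = Suc CARD('d)"
    and vertex: "\<lbrakk>u \<in> C; v \<in> C\<rbrakk> \<Longrightarrow> \<alpha> v \<bullet> u + \<beta> v = (if u = v then 1 else 0)"
    and sum_1: "(\<Sum>v\<in>C. \<alpha> v \<bullet> x + \<beta> v) = 1"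
    and combination: "(\<Sum>v\<in>C. (\<alpha> v \<bullet> x + \<beta> v) *\<^sub>R v) = x"
begin

definition coord :: "real^'d \<Rightarrow> real^'d \<Rightarrow> real" where
  "coord v x = \<alpha> v \<bullet> x + \<beta> v"

definition face :: "real^'d \<Rightarrow> (real^'d) set" where
  "face a = convex hull (C - {a})"

lemma coord_vertex: "\<lbrakk>u \<in> C; v \<in> C\<rbrakk> \<Longrightarrow> coord v u = (if u = v then 1 else 0)"
  using vertex by (simp add: coord_def)

lemma coord_sum: "(\<Sum>v\<in>C. coord v x) = 1"
  using sum_1 by (simp add: coord_def)

lemma coord_combination: "(\<Sum>v\<in>C. coord v x *\<^sub>R v) = x"
  using combination by (simp add: coord_def)

lemma coord_diff: "coord v y - coord v x = \<alpha> v \<bullet> (y - x)"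
  by (simp add: coord_def inner_diff_right)

lemma grad_edge:
  "\<lbrakk>a \<in> C; b \<in> C; v \<in> C\<rbrakk> \<Longrightarrow> \<alpha> v \<bullet> (a - b) = (if v = a then 1 else 0) - (if v = b then 1 else 0)"
  using coord_diff[of v a b] coord_vertex by auto

lemma coord_along_edge:
  "\<lbrakk>a \<in> C; b \<in> C; v \<in> C\<rbrakk> \<Longrightarrow>
    coord v (x + s *\<^sub>R (a - b)) = coord v x + s * ((if v = a then 1 else 0) - (if v = b then 1 else 0))"
  using grad_edge[of a b v] by (simp add: coord_def inner_add_right)

lemma coord_continuous: "continuous_on X (coord v)"
  unfolding coord_def by (intro continuous_intros)

lemma coord_affine: "sum u D = 1 \<Longrightarrow> coord v (\<Sum>x\<in>D. u x *\<^sub>R x) = (\<Sum>x\<in>D. u x * coord v x)"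
  by (simp add: coord_def inner_sum_right distrib_left sum.distrib sum_distrib_right[symmetric])

lemma other_vertex: obtains b where "b \<in> C" "b \<noteq> a"
proof -
  have "\<not> C \<subseteq> {a}"
  proof
    assume "C \<subseteq> {a}"
    then have "card C \<le> 1" using card_mono[of "{a}" C] by simp
    then show False using card_C by simp
  qed
  then show ?thesis using that by blast
qed

lemma hull_subset_iff:
  assumes "D \<subseteq> C"
  shows "x \<in> convex hull D \<longleftrightarrow> (\<forall>v\<in>C. 0 \<le> coord v x) \<and> (\<forall>v\<in>C - D. coord v x = 0)"
proof
  have fin: "finite D" using finite_subset[OF assms finite_C] .
  assume "x \<in> convex hull D"
  then obtain u where u: "\<And>y. y \<in> D \<Longrightarrow> 0 \<le> u y" "sum u D = 1" "(\<Sum>y\<in>D. u y *\<^sub>R y) = x"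
    unfolding convex_hull_finite[OF fin] by blast
  have *: "coord v x = (\<Sum>y\<in>D. if y = v then u y else 0)" if "v \<in> C" for v
    unfolding u(3)[symmetric] coord_affine[OF u(2)]
    by (rule sum.cong) (use assms that coord_vertex in auto)
  show "(\<forall>v\<in>C. 0 \<le> coord v x) \<and> (\<forall>v\<in>C - D. coord v x = 0)"
    using u(1) fin by (auto simp: *)
next
  have fin: "finite D" using finite_subset[OF assms finite_C] .
  assume x: "(\<forall>v\<in>C. 0 \<le> coord v x) \<and> (\<forall>v\<in>C - D. coord v x = 0)"
  have "(\<Sum>v\<in>D. coord v x) = (\<Sum>v\<in>C. coord v x)" "(\<Sum>v\<in>D. coord v x *\<^sub>R v) = (\<Sum>v\<in>C. coord v x *\<^sub>R v)"
    using x assms finite_C by (auto intro!: sum.mono_neutral_left)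
  then show "x \<in> convex hull D"
    unfolding convex_hull_finite[OF fin] using x assms coord_sum coord_combination
    by (intro CollectI exI[of _ "\<lambda>v. coord v x"]) auto
qed

lemma hull_iff: "x \<in> convex hull C \<longleftrightarrow> (\<forall>v\<in>C. 0 \<le> coord v x)"
  using hull_subset_iff[of C x] by simp

lemma face_iff: "a \<in> C \<Longrightarrow> x \<in> face a \<longleftrightarrow> x \<in> convex hull C \<and> coord a x = 0"
  unfolding face_def hull_iff using hull_subset_iff[of "C - {a}" x] by auto

lemma compact_face: "compact (face a)"
  unfolding face_def using finite_C by (simp add: finite_imp_compact_convex_hull)

lemma vertex_in_face: "\<lbrakk>b \<in> C; b \<noteq> a\<rbrakk> \<Longrightarrow> b \<in> face a"
  unfolding face_def by (simp add: hull_inc)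

lemma grad_nonzero: "a \<in> C \<Longrightarrow> \<alpha> a \<noteq> 0"
  using grad_edge[of a _ a] other_vertex[of a] by (metis diff_zero inner_zero_left zero_neq_one)

text \<open>The barycentre has positive coordinates, so a ball around it lies in the simplex.\<close>

lemma measure_simplex_pos: "0 < measure lborel (convex hull C)"
proof -
  define m where "m = (\<Sum>v\<in>C. (1 / card C) *\<^sub>R v)"
  have card: "card C > 0" using card_C by simp
  have m: "coord v m = 1 / card C" if "v \<in> C" for v
  proof -
    have "coord v m = (\<Sum>x\<in>C. 1 / card C * coord v x)"
      unfolding m_def by (rule coord_affine) (use card in simp)
    also have "\<dots> = (\<Sum>x\<in>C. if x = v then 1 / card C else 0)"
      by (rule sum.cong) (use that coord_vertex in auto)
    finally show ?thesis using that finite_C by simp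
  qed
  have "open (\<Inter>v\<in>C. {x. 0 < coord v x})"
    using finite_C by (intro open_INT ballI open_Collect_less coord_continuous continuous_intros) auto
  moreover have "m \<in> (\<Inter>v\<in>C. {x. 0 < coord v x})" using m card by simp
  ultimately obtain r where r: "r > 0" "ball m r \<subseteq> (\<Inter>v\<in>C. {x. 0 < coord v x})"
    by (meson open_contains_ball)
  have "ball m r \<subseteq> convex hull C"
  proof
    fix x assume "x \<in> ball m r"
    with r(2) have "x \<in> (\<Inter>v\<in>C. {x. 0 < coord v x})" by blast
    then show "x \<in> convex hull C" by (auto simp: hull_iff intro: less_imp_le)
  qed
  moreover have "compact (convex hull C)" using finite_C by (rule finite_imp_compact_convex_hull)
  ultimately have "measure lborel (ball m r) \<le> measure lborel (convex hull C)"
    using emeasure_compact_finite by (intro measure_mono_fmeasurable) (auto simp: fmeasurable_def borel_compact)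
  then show ?thesis using content_ball_pos[OF r(1), of m] by linarith
qed

text \<open>An affine function constant on a facet is determined up to a factor, hence a multiple of the
  barycentric coordinate of the opposite vertex.\<close>

lemma normal_of_face:
  assumes a: "a \<in> C" and \<nu>: "face a \<subseteq> {x. \<nu> \<bullet> x = c}"
  obtains \<kappa> where "\<nu> = \<kappa> *\<^sub>R \<alpha> a" "\<And>x. \<nu> \<bullet> x - c = \<kappa> * coord a x"
proof -
  define \<kappa> where "\<kappa> = \<nu> \<bullet> a - c"
  have eq: "\<nu> \<bullet> x - c = \<kappa> * coord a x" for x
  proof -
    have "\<nu> \<bullet> v - c = (if v = a then \<kappa> else 0)" if "v \<in> C" for v
      using \<nu> vertex_in_face[of v a] that by (auto simp: \<kappa>_def)
    then have "(\<Sum>v\<in>C. coord v x * (\<nu> \<bullet> v - c)) = (\<Sum>v\<in>C. if v = a then \<kappa> * coord a x else 0)"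
      by (intro sum.cong) auto
    moreover have "(\<Sum>v\<in>C. coord v x * (\<nu> \<bullet> v - c)) = \<nu> \<bullet> (\<Sum>v\<in>C. coord v x *\<^sub>R v) - (\<Sum>v\<in>C. coord v x) * c"
      by (simp add: inner_sum_right right_diff_distrib sum_subtractf sum_distrib_right)
    ultimately show ?thesis using a finite_C by (simp add: coord_combination coord_sum)
  qed
  have "\<nu> \<bullet> x = \<kappa> *\<^sub>R \<alpha> a \<bullet> x" for x
    using eq[of x] eq[of 0] by (simp add: coord_def algebra_simps)
  then have "\<nu> = \<kappa> *\<^sub>R \<alpha> a" by (metis vector_eq_rdot)
  then show ?thesis using that eq by blast
qed

text \<open>The sign \<open>\<sigma>\<close> tells on which side of the facet \<open>K\<close> lies. The point \<open>y0\<close> off the hyperplane makes the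
  inner normal unique.\<close>

lemma inward_normal_face:
  assumes a: "a \<in> C" and \<sigma>: "\<bar>\<sigma>\<bar> = 1"
    and side: "\<And>y. y \<in> K \<Longrightarrow> 0 \<le> \<sigma> * coord a y" and off: "y0 \<in> K" "coord a y0 \<noteq> 0"
  shows "inward_normal (face a) K = (\<sigma> / norm (\<alpha> a)) *\<^sub>R \<alpha> a"
  unfolding inward_normal_def
proof (rule the_equality)
  have na: "norm (\<alpha> a) > 0" using grad_nonzero[OF a] by simp
  have zero: "coord a x = 0" if "x \<in> face a" for x using that face_iff[OF a] by blast
  let ?\<nu> = "(\<sigma> / norm (\<alpha> a)) *\<^sub>R \<alpha> a"
  have \<nu>: "?\<nu> \<bullet> (y - x) = (\<sigma> * (coord a y - coord a x)) / norm (\<alpha> a)" for x y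
    by (simp add: coord_diff)
  show "norm ?\<nu> = 1 \<and> (\<forall>x\<in>face a. \<forall>y\<in>face a. ?\<nu> \<bullet> (y - x) = 0) \<and> (\<forall>x\<in>face a. \<forall>y\<in>K. 0 \<le> ?\<nu> \<bullet> (y - x))"
    unfolding \<nu> using na \<sigma> side by (simp add: zero)
  fix \<nu> assume \<nu>: "norm \<nu> = 1 \<and> (\<forall>x\<in>face a. \<forall>y\<in>face a. \<nu> \<bullet> (y - x) = 0) \<and> (\<forall>x\<in>face a. \<forall>y\<in>K. 0 \<le> \<nu> \<bullet> (y - x))"
  obtain b where b: "b \<in> C" "b \<noteq> a" by (rule other_vertex)
  have bf: "b \<in> face a" by (rule vertex_in_face[OF b])
  have "face a \<subseteq> {x. \<nu> \<bullet> x = \<nu> \<bullet> b}"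
  proof
    fix x assume "x \<in> face a"
    then have "\<nu> \<bullet> (x - b) = 0" using \<nu> bf by blast
    then show "x \<in> {x. \<nu> \<bullet> x = \<nu> \<bullet> b}" by (simp add: inner_diff_right)
  qed
  then obtain \<kappa> where \<kappa>: "\<nu> = \<kappa> *\<^sub>R \<alpha> a" "\<And>x. \<nu> \<bullet> x - \<nu> \<bullet> b = \<kappa> * coord a x"
    using normal_of_face[OF a] by blast
  have abs: "\<bar>\<kappa>\<bar> = 1 / norm (\<alpha> a)" using \<nu> \<kappa>(1) na by (simp add: field_simps)
  have "0 \<le> \<kappa> * coord a y0" 
    unfolding \<kappa>(2)[symmetric] inner_diff_right[symmetric] using \<nu> bf off(1) by blast
  moreover have "0 \<le> \<sigma> * coord a y0" using side[OF off(1)] .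
  moreover have "\<sigma> = 1 \<or> \<sigma> = -1" using \<sigma> by linarith
  ultimately have "\<kappa> = \<sigma> / norm (\<alpha> a)"
    using abs off(2) na by (auto simp: abs_if zero_le_mult_iff field_simps split: if_splits)
  then show "\<nu> = ?\<nu>" using \<kappa>(1) by simp
qed

text \<open>With this normalization the integral of \<open>g\<close> times the outer unit normal over the facet opposite
  \<open>a\<close> is \<open>- facet_flux a g *\<^sub>R \<alpha> a\<close>.\<close>

definition facet_flux :: "real^'d \<Rightarrow> (real^'d \<Rightarrow> real) \<Rightarrow> real" where
  "facet_flux a g = (LINT x:face a|facet_measure (face a). g x) / norm (\<alpha> a)"

text \<open>A formula free of the arbitrary choice of a hyperplane equation in \<open>facet_measure\<close>, with the
  prism over the facet in the direction of any edge that leaves it.\<close>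

lemma facet_flux_eq:
  assumes a: "a \<in> C" and b: "b \<in> C" "b \<noteq> a" and g: "continuous_on UNIV g"
  shows "facet_flux a g = (LINT x|lborel. indicator {0..1} (coord a x) *
      (indicator (face a) (x - coord a x *\<^sub>R (a - b)) * g (x - coord a x *\<^sub>R (a - b))))"
proof -
  have na: "norm (\<alpha> a) > 0" using grad_nonzero[OF a] by simp
  let ?P = "\<lambda>(\<nu>, c). norm \<nu> = 1 \<and> face a \<subseteq> {x. \<nu> \<bullet> x = c}"
  have "\<alpha> a \<bullet> x = - \<beta> a" if "x \<in> face a" for x
    using that face_iff[OF a] by (auto simp: coord_def)
  then have "?P (\<alpha> a /\<^sub>R norm (\<alpha> a), - \<beta> a / norm (\<alpha> a))"
    using na by (auto simp: divide_inverse)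
  then have "?P (SOME z. ?P z)" by (rule someI)
  then obtain \<nu> c where P: "norm \<nu> = 1" "face a \<subseteq> {x. \<nu> \<bullet> x = c}"
    and fm: "facet_measure (face a) = hyperplane_measure \<nu> c"
    unfolding facet_measure_def by (cases "SOME z. ?P z") auto
  obtain \<kappa> where \<kappa>: "\<nu> = \<kappa> *\<^sub>R \<alpha> a" "\<And>x. \<nu> \<bullet> x - c = \<kappa> * coord a x"
    using normal_of_face[OF a P(2)] by blast
  have "\<alpha> a \<bullet> (a - b) = 1" using grad_edge[of a b a] a b by simp
  then have e: "\<nu> \<bullet> (a - b) = \<kappa>" by (simp add: \<kappa>(1))
  have abs: "\<bar>\<kappa>\<bar> = 1 / norm (\<alpha> a)" using P(1) \<kappa>(1) na by (simp add: field_simps)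
  then have "\<kappa> \<noteq> 0" using na by auto
  have "(LINT x:face a|hyperplane_measure \<nu> c. g x) * \<bar>\<nu> \<bullet> (a - b)\<bar> = (LINT x|lborel. indicator {0..1} (coord a x) *
      (indicator (face a) (x - coord a x *\<^sub>R (a - b)) * g (x - coord a x *\<^sub>R (a - b))))"
    by (rule integral_hyperplane_measure_oblique[OF compact_face g])
       (use P e \<kappa>(2) \<open>\<kappa> \<noteq> 0\<close> in auto)
  then show ?thesis by (simp add: facet_flux_def fm e abs)
qed

lemma in_face_shift_iff:
  assumes "a \<in> C" "b \<in> C" "b \<noteq> a"
  shows "x - coord a x *\<^sub>R (a - b) \<in> face a \<longleftrightarrow> 0 \<le> coord a x + coord b x \<and> (\<forall>v\<in>C - {a, b}. 0 \<le> coord v x)"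
proof -
  define y where "y = x - coord a x *\<^sub>R (a - b)"
  have *: "coord v y = coord v x - coord a x * ((if v = a then 1 else 0) - (if v = b then 1 else 0))"
    if "v \<in> C" for v
    using coord_along_edge[OF assms(1,2) that, of x "- coord a x"] by (simp add: y_def)
  have "coord a y = 0" "coord b y = coord a x + coord b x" "\<And>v. v \<in> C - {a, b} \<Longrightarrow> coord v y = coord v x"
    using * assms by auto
  then show ?thesis
    unfolding y_def[symmetric] face_iff[OF assms(1)] hull_iff using assms
    by (metis Diff_iff insertE insertI1 insertI2 order_refl singletonD)
qed

text \<open>The oblique prism over a facet contains the simplex.\<close>

lemma facet_flux_1_pos:
  assumes a: "a \<in> C" shows "0 < facet_flux a (\<lambda>x. 1)"
proof -
  obtain b where b: "b \<in> C" "b \<noteq> a" by (rule other_vertex)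
  let ?P = "{x. coord a x \<in> {0..1} \<and> x - coord a x *\<^sub>R (a - b) \<in> face a}"
  have P: "compact ?P" by (intro compact_prism compact_face compact_Icc coord_continuous)
  have "convex hull C \<subseteq> ?P"
  proof
    fix x assume "x \<in> convex hull C"
    then have x: "\<And>v. v \<in> C \<Longrightarrow> 0 \<le> coord v x" by (simp add: hull_iff)
    have "coord a x \<le> (\<Sum>v\<in>C. coord v x)" using a x finite_C by (intro member_le_sum) auto
    then show "x \<in> ?P" using x a b by (auto simp: in_face_shift_iff coord_sum)
  qed
  then have "measure lborel (convex hull C) \<le> measure lborel ?P"
    using emeasure_compact_finite[OF P] P finite_imp_compact_convex_hull[OF finite_C]
    by (intro measure_mono_fmeasurable) (auto simp: fmeasurable_def borel_compact)
  also have "measure lborel ?P = (LINT x|lborel. indicator ?P x)" by simp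
  also have "\<dots> = facet_flux a (\<lambda>x. 1)"
    unfolding facet_flux_eq[OF a b continuous_on_const]
    by (rule Bochner_Integration.integral_cong) (auto simp: indicator_def)
  finally show ?thesis using measure_simplex_pos by linarith
qed

lemma facet_measure_face:
  assumes a: "a \<in> C"
  shows "measure (facet_measure (face a)) (face a) = norm (\<alpha> a) * facet_flux a (\<lambda>x. 1)"
    and "face_avg (face a) g = facet_flux a g / facet_flux a (\<lambda>x. 1)"
    and "(LINT x:face a|facet_measure (face a). v) = (norm (\<alpha> a) * facet_flux a (\<lambda>x. 1)) *\<^sub>R (v::real^'d)"
proof -
  have na: "norm (\<alpha> a) > 0" using grad_nonzero[OF a] by simp
  have space: "space (facet_measure (face a)) = UNIV" and sets: "sets (facet_measure (face a)) = sets borel"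
    unfolding facet_measure_def hyperplane_measure_def by (auto split: prod.split)
  have "facet_flux a (\<lambda>x. 1) = measure (facet_measure (face a)) (face a) / norm (\<alpha> a)"
    unfolding facet_flux_def set_lebesgue_integral_def by (simp add: space)
  then show m: "measure (facet_measure (face a)) (face a) = norm (\<alpha> a) * facet_flux a (\<lambda>x. 1)"
    using na by simp
  show "face_avg (face a) g = facet_flux a g / facet_flux a (\<lambda>x. 1)"
    using na by (simp add: face_avg_def m facet_flux_def[of a g])
  have "measure (facet_measure (face a)) (face a) > 0" using m na facet_flux_1_pos[OF a] by simp
  then have "emeasure (facet_measure (face a)) (face a) \<noteq> \<infinity>"
    by (auto simp: measure_def)
  then show "(LINT x:face a|facet_measure (face a). v) = (norm (\<alpha> a) * facet_flux a (\<lambda>x. 1)) *\<^sub>R v"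
    using compact_face[of a] by (subst set_integral_const) (auto simp: sets m borel_compact)
qed

section \<open>The divergence theorem on a simplex\<close>

text \<open>A line in the direction of the edge from \<open>b\<close> to \<open>a\<close> meets the simplex in a segment from the facet
  opposite \<open>a\<close> to the facet opposite \<open>b\<close>, and the fundamental theorem of calculus applies on it. The
  integral over the end points is brought to the form of \<open>facet_flux_eq\<close> for \<open>b\<close> by a change of the
  slab that parametrizes the lines, from \<open>0 \<le> coord a \<le> 1\<close> to \<open>0 \<le> coord b \<le> 1\<close>.\<close>

lemma edge_derivative_integral:
  assumes a: "a \<in> C" and b: "b \<in> C" "b \<noteq> a" and g: "has_continuous_gradient g G"
  shows "(LINT x:convex hull C|lborel. G x \<bullet> (a - b)) = facet_flux b g - facet_flux a g"
proof -
  define e where "e = a - b"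
  \<comment> \<open>\<open>p x\<close> and \<open>q x\<close> are the points where the line through \<open>x\<close> meets the hyperplanes of the facets
    opposite \<open>a\<close> and \<open>b\<close>, and \<open>L x\<close> indicates whether it meets the simplex.\<close>
  define p where "p x = x - coord a x *\<^sub>R e" for x
  define q where "q x = x + coord b x *\<^sub>R e" for x
  define L where "L x = indicat_real (face a) (p x)" for x
  have ca: "coord a (x + s *\<^sub>R e) = coord a x + s" and cb: "coord b (x + s *\<^sub>R e) = coord b x - s" for x s
    using coord_along_edge[OF a b(1) a, of x s] coord_along_edge[OF a b(1) b(1), of x s] b(2)
    by (simp_all add: e_def)
  have pe: "p (x + s *\<^sub>R e) = p x" and qe: "q (x + s *\<^sub>R e) = q x" for x s
    by (simp_all add: p_def q_def ca cb algebra_simps)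
  have Le: "L (x + s *\<^sub>R e) = L x" for x s by (simp add: L_def pe)
  have p_face: "p x \<in> face a \<longleftrightarrow> 0 \<le> coord a x + coord b x \<and> (\<forall>v\<in>C - {a, b}. 0 \<le> coord v x)" for x
    unfolding p_def e_def by (rule in_face_shift_iff[OF a b])
  have q_face: "q x \<in> face b \<longleftrightarrow> p x \<in> face a" for x
    using in_face_shift_iff[OF b(1) a b(2)[symmetric], of x]
    by (simp add: q_def e_def p_face insert_commute add.commute algebra_simps)
  have gc: "continuous_on UNIV g" using g by (rule has_continuous_gradient_continuous)
  have Gc: "continuous_on UNIV G" and gd: "\<And>x. (g has_derivative (\<lambda>h. G x \<bullet> h)) (at x)"
    using g by (auto simp: has_continuous_gradient_def)
  have cm: "coord v \<in> borel_measurable borel" for v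
    by (rule borel_measurable_continuous_onI[OF coord_continuous])
  have gp: "continuous_on UNIV (\<lambda>x. g (p x))" and gq: "continuous_on UNIV (\<lambda>x. g (q x))"
    unfolding p_def q_def
    by (auto intro!: continuous_on_compose2[OF gc] continuous_intros coord_continuous)
  have int: "integrable lborel (\<lambda>x. indicator {0..1} (coord a x) * (L x * k x))"
    if "continuous_on UNIV k" for k
    unfolding L_def p_def
    by (rule integrable_on_prism[OF compact_face compact_Icc coord_continuous that])
  have int_b: "integrable lborel (\<lambda>x. indicator {0..1} (coord b x) * (L x * g (q x)))"
  proof -
    have "L x = indicator (face b) (x - coord b x *\<^sub>R (b - a))" for x
      using q_face[of x] by (simp add: L_def q_def e_def indicator_def algebra_simps)
    then show ?thesis
      using integrable_on_prism[OF compact_face compact_Icc coord_continuous gq] by simp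
  qed
  have flux_a: "facet_flux a g = (LINT x|lborel. indicator {0..1} (coord a x) * (L x * g (p x)))"
    unfolding facet_flux_eq[OF a b gc] by (simp add: L_def p_def e_def)
  have "x - coord b x *\<^sub>R (b - a) = q x" for x by (simp add: q_def e_def algebra_simps)
  then have "facet_flux b g = (LINT x|lborel. indicator {0..1} (coord b x) * (L x * g (q x)))"
    unfolding facet_flux_eq[OF b(1) a b(2)[symmetric] gc] by (simp add: L_def indicator_def q_face)
  also have "\<dots> = (LINT x|lborel. indicator {0..1} (coord a x) *
      (LINT s|lborel. indicator {0..1} (coord b (x + s *\<^sub>R e)) * (L (x + s *\<^sub>R e) * g (q (x + s *\<^sub>R e)))))"
    by (rule integral_by_parallel_lines[OF int_b cm ca])
  also have "\<dots> = (LINT x|lborel. indicator {0..1} (coord a x) * (L x * g (q x)))"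
  proof -
    have "(\<lambda>s. indicator {0..1} (coord b x - s)) = indicat_real {coord b x - 1..coord b x}" for x
      by (auto simp: indicator_def fun_eq_iff)
    then have "(LINT s|lborel. indicat_real {0..1} (coord b x - s)) = 1" for x by (simp only:) simp
    then show ?thesis by (simp add: cb Le qe)
  qed
  finally have flux_b: "facet_flux b g = (LINT x|lborel. indicator {0..1} (coord a x) * (L x * g (q x)))" .
  have segment: "(LINT s|lborel. indicator (convex hull C) (x + s *\<^sub>R e) *\<^sub>R (G (x + s *\<^sub>R e) \<bullet> e))
      = L x * g (q x) - L x * g (p x)" for x
  proof (cases "p x \<in> face a")
    case True
    then have le: "- coord a x \<le> coord b x" by (simp add: p_face)
    have "x + s *\<^sub>R e \<in> convex hull C \<longleftrightarrow> s \<in> {- coord a x..coord b x}" for s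
    proof -
      have "coord v (x + s *\<^sub>R e) = coord v x" if "v \<in> C - {a, b}" for v
        using that coord_along_edge[OF a b(1), of v x s] by (simp add: e_def)
      then have "x + s *\<^sub>R e \<in> convex hull C \<longleftrightarrow> 0 \<le> coord a (x + s *\<^sub>R e) \<and> 0 \<le> coord b (x + s *\<^sub>R e)"
        using True a b unfolding hull_iff p_face by (metis DiffI insert_iff singletonD)
      then show ?thesis by (auto simp: ca cb)
    qed
    then have "(LINT s|lborel. indicator (convex hull C) (x + s *\<^sub>R e) *\<^sub>R (G (x + s *\<^sub>R e) \<bullet> e))
        = (LINT s|lborel. indicator {- coord a x..coord b x} s *\<^sub>R (G (x + s *\<^sub>R e) \<bullet> e))"
      by (simp add: indicator_def)
    also have "\<dots> = g (x + coord b x *\<^sub>R e) - g (x + (- coord a x) *\<^sub>R e)"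
    proof (rule integral_FTC_atLeastAtMost[OF le])
      fix s
      have "((\<lambda>s. g (x + s *\<^sub>R e)) has_derivative (\<lambda>h. G (x + s *\<^sub>R e) \<bullet> (h *\<^sub>R e))) (at s within {- coord a x..coord b x})"
        by (rule has_derivative_compose[OF _ gd]) (auto intro!: derivative_eq_intros)
      then show "((\<lambda>s. g (x + s *\<^sub>R e)) has_vector_derivative G (x + s *\<^sub>R e) \<bullet> e) (at s within {- coord a x..coord b x})"
        by (simp add: has_vector_derivative_def mult.commute)
    next
      show "continuous_on {- coord a x..coord b x} (\<lambda>s. G (x + s *\<^sub>R e) \<bullet> e)"
        by (auto intro!: continuous_intros continuous_on_compose2[OF Gc])
    qed
    finally show ?thesis using True by (simp add: L_def p_def q_def)
  next
    case False
    have "p x \<in> face a" if "x + s *\<^sub>R e \<in> convex hull C" for s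
    proof -
      have "0 \<le> coord v (x + s *\<^sub>R e)" if "v \<in> C" for v
        using \<open>x + s *\<^sub>R e \<in> convex hull C\<close> that by (simp add: hull_iff)
      then have "p (x + s *\<^sub>R e) \<in> face a" unfolding p_face using a b by simp
      then show ?thesis by (simp add: pe)
    qed
    then have "\<And>s. x + s *\<^sub>R e \<notin> convex hull C" using False by blast
    then show ?thesis using False by (simp add: L_def)
  qed
  have "integrable lborel (\<lambda>x. indicator (convex hull C) x *\<^sub>R (G x \<bullet> e))"
    using finite_imp_compact_convex_hull[OF finite_C] Gc
    by (intro borel_integrable_compact continuous_intros) (auto intro: continuous_on_subset)
  from integral_by_parallel_lines[OF this cm ca]
  have "(LINT x:convex hull C|lborel. G x \<bullet> e)
      = (LINT x|lborel. indicator {0..1} (coord a x) * (L x * g (q x) - L x * g (p x)))"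
    by (simp only: set_lebesgue_integral_def segment)
  also have "\<dots> = facet_flux b g - facet_flux a g"
    unfolding flux_a flux_b right_diff_distrib
    by (rule Bochner_Integration.integral_diff[OF int[OF gq] int[OF gp]])
  finally show ?thesis by (simp add: e_def)
qed

text \<open>Both sides have the same inner product with every edge vector \<open>a - b\<close>, since all the \<open>\<alpha> v\<close> other
  than \<open>\<alpha> a\<close> and \<open>\<alpha> b\<close> are orthogonal to it; and the edge vectors span the space.\<close>

theorem divergence_theorem_simplex:
  assumes g: "has_continuous_gradient g G"
  shows "(LINT x:convex hull C|lborel. G x) = - (\<Sum>a\<in>C. facet_flux a g *\<^sub>R \<alpha> a)"
proof -
  define X where "X = (LINT x:convex hull C|lborel. G x)"
  define Y where "Y = - (\<Sum>a\<in>C. facet_flux a g *\<^sub>R \<alpha> a)"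
  have Gc: "continuous_on UNIV G" using g by (auto simp: has_continuous_gradient_def)
  have "set_integrable lborel (convex hull C) G"
    unfolding set_integrable_def
    using finite_imp_compact_convex_hull[OF finite_C] Gc
    by (intro borel_integrable_compact) (auto intro: continuous_on_subset)
  then have X: "X \<bullet> e = (LINT x:convex hull C|lborel. G x \<bullet> e)" for e
    unfolding X_def set_lebesgue_integral_def set_integrable_def
    by (subst integral_inner_left[symmetric]) auto
  obtain b where b: "b \<in> C" using card_C by fastforce
  have "(X - Y) \<bullet> (a - b) = 0" if a: "a \<in> C" for a
  proof (cases "a = b")
    case False
    have "Y \<bullet> (a - b) = - (\<Sum>v\<in>C. facet_flux v g * (\<alpha> v \<bullet> (a - b)))"
      by (simp add: Y_def inner_sum_left)
    also have "(\<Sum>v\<in>C. facet_flux v g * (\<alpha> v \<bullet> (a - b)))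
        = (\<Sum>v\<in>C. (if v = a then facet_flux v g else 0) - (if v = b then facet_flux v g else 0))"
      by (rule sum.cong) (auto simp: grad_edge a b)
    also have "\<dots> = facet_flux a g - facet_flux b g"
      using a b finite_C by (simp add: sum_subtractf)
    finally show ?thesis
      using edge_derivative_integral[OF a b False[symmetric] g] by (simp add: X inner_diff_left)
  qed simp
  then have const: "(X - Y) \<bullet> a = (X - Y) \<bullet> b" if "a \<in> C" for a using that by (simp add: inner_diff_right)
  have "(X - Y) \<bullet> x = (X - Y) \<bullet> b" for x
  proof -
    have "(X - Y) \<bullet> x = (\<Sum>v\<in>C. coord v x * ((X - Y) \<bullet> v))"
      by (subst coord_combination[of x, symmetric]) (simp add: inner_sum_right)
    also have "\<dots> = (\<Sum>v\<in>C. coord v x) * ((X - Y) \<bullet> b)"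
      unfolding sum_distrib_right by (rule sum.cong) (simp_all add: const)
    finally show ?thesis by (simp add: coord_sum)
  qed
  from this[of 0] this[of "X - Y"] have "(X - Y) \<bullet> (X - Y) = 0" by simp
  then have "X = Y" by simp
  then show ?thesis by (simp add: X_def Y_def)
qed

end

text \<open>Relative to another vertex \<open>b\<close>, the remaining vertices form a linearly independent set, so there is a
  linear functional that is 1 at \<open>v - b\<close> and 0 at the other edge vectors from \<open>b\<close>.\<close>

lemma simplex_barycentric:
  assumes "int CARD('d) simplex (T :: (real^'d) set)"
  obtains C \<alpha> \<beta> where "barycentric C \<alpha> \<beta>" "T = convex hull C" "\<not> affine_dependent C"
proof -
  obtain C where C: "finite C" "\<not> affine_dependent C" "int (card C) = int CARD('d) + 1" "T = convex hull C"
    using assms by (auto simp: simplex)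
  have card: "card C = Suc CARD('d)" using C(3) by simp
  have "\<exists>\<alpha> \<beta>. \<forall>u\<in>C. \<alpha> \<bullet> u + \<beta> = (if u = v then 1 else 0 :: real)" if v: "v \<in> C" for v
  proof -
    have "\<not> C \<subseteq> {v}"
    proof
      assume "C \<subseteq> {v}"
      then have "card C \<le> 1" using card_mono[of "{v}" C] by simp
      then show False using card by simp
    qed
    then obtain b where b: "b \<in> C" "b \<noteq> v" by blast
    have "independent ((\<lambda>x. - b + x) ` (C - {b}))"
      using C(2) affine_dependent_iff_dependent2[OF b(1)] by simp
    from linear_independent_extend[OF this, of "\<lambda>x. if x = v - b then 1 else 0 :: real"]
    obtain f :: "real^'d \<Rightarrow> real" where f: "linear f"
        "\<forall>x\<in>(\<lambda>x. - b + x) ` (C - {b}). f x = (if x = v - b then 1 else 0)"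
      by blast
    have fa: "f x = adjoint f 1 \<bullet> x" for x
      using adjoint_works[OF f(1), of x 1] by (simp add: inner_commute)
    have "f (u - b) = (if u = v then 1 else 0)" if "u \<in> C" for u
    proof (cases "u = b")
      case True
      then show ?thesis using b linear_0[OF f(1)] by simp
    next
      case False
      then have "- b + u \<in> (\<lambda>x. - b + x) ` (C - {b})" using that by blast
      with f(2) show ?thesis by fastforce
    qed
    then show ?thesis
      by (intro exI[of _ "adjoint f 1"] exI[of _ "- (adjoint f 1 \<bullet> b)"]) (auto simp: fa inner_diff_right)
  qed
  then obtain \<alpha> \<beta> where vertex: "\<And>u v. \<lbrakk>u \<in> C; v \<in> C\<rbrakk> \<Longrightarrow> \<alpha> v \<bullet> u + \<beta> v = (if u = v then 1 else 0 :: real)"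
    by metis
  have coef: "(\<Sum>v\<in>C. \<alpha> v \<bullet> x + \<beta> v) = 1 \<and> (\<Sum>v\<in>C. (\<alpha> v \<bullet> x + \<beta> v) *\<^sub>R v) = x" for x
  proof -
    have "x \<in> affine hull C" using affine_independent_span_eq[OF C(2)] card by simp
    then obtain u where u: "sum u C = 1" "(\<Sum>v\<in>C. u v *\<^sub>R v) = x"
      unfolding affine_hull_finite[OF C(1)] by blast
    have "\<alpha> v \<bullet> x + \<beta> v = u v" if "v \<in> C" for v
    proof -
      have "\<alpha> v \<bullet> x + \<beta> v = \<alpha> v \<bullet> (\<Sum>w\<in>C. u w *\<^sub>R w) + sum u C * \<beta> v" by (simp only: u mult_1)
      also have "\<dots> = (\<Sum>w\<in>C. u w * (\<alpha> v \<bullet> w + \<beta> v))"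
        by (simp add: inner_sum_right distrib_left sum.distrib sum_distrib_right)
      also have "\<dots> = (\<Sum>w\<in>C. if w = v then u w else 0)"
        by (rule sum.cong) (auto simp: vertex that)
      finally show ?thesis using that C(1) by simp
    qed
    then show ?thesis using u by simp
  qed
  have "barycentric C \<alpha> \<beta>" by unfold_locales (use C(1) card vertex coef in auto)
  then show ?thesis using that C by blast
qed

section \<open>Simplices meeting along a facet\<close>

context barycentric
begin

lemma facet_iff: 
  assumes "\<not> affine_dependent C"
  shows "F facet_of convex hull C \<longleftrightarrow> (\<exists>a\<in>C. F = face a)"
proof -
  have "face a \<noteq> {}" for a
    using other_vertex[of a] vertex_in_face by (metis empty_iff)
  then show ?thesis unfolding facet_of_convex_hull_affine_independent[OF assms] face_def by blast
qed

definition facet_centre :: "real^'d \<Rightarrow> real^'d" where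
  "facet_centre a = (\<Sum>v\<in>C - {a}. (1 / CARD('d)) *\<^sub>R v)"

lemma coord_centre:
  assumes "a \<in> C" "v \<in> C" shows "coord v (facet_centre a) = (if v = a then 0 else 1 / CARD('d))"
proof -
  have "card (C - {a}) = CARD('d)" using card_C assms(1) finite_C by simp
  then have "coord v (facet_centre a) = (\<Sum>x\<in>C - {a}. 1 / CARD('d) * coord v x)"
    unfolding facet_centre_def by (intro coord_affine) simp
  also have "\<dots> = (\<Sum>x\<in>C - {a}. if x = v then 1 / CARD('d) else 0)"
    by (rule sum.cong) (use assms coord_vertex in auto)
  finally show ?thesis using finite_C assms by simp
qed

lemma centre_in_face: "a \<in> C \<Longrightarrow> facet_centre a \<in> face a"
  by (simp add: face_iff hull_iff coord_centre)

text \<open>All coordinates but that of \<open>a\<close> are positive at the centre of the facet, so a short step from there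
  leaves the simplex only if the coordinate of \<open>a\<close> becomes negative.\<close>

lemma segment_from_centre:
  assumes a: "a \<in> C" and y: "0 \<le> coord a y"
  obtains \<delta> where "0 < \<delta>" "\<delta> < 1" "facet_centre a + \<delta> *\<^sub>R (y - facet_centre a) \<in> convex hull C"
    "coord a (facet_centre a + \<delta> *\<^sub>R (y - facet_centre a)) = \<delta> * coord a y"
proof -
  let ?m = "facet_centre a"
  let ?U = "\<Inter>v\<in>C - {a}. {x. 0 < coord v x}"
  have "open ?U"
    using finite_C by (intro open_INT ballI open_Collect_less coord_continuous continuous_intros) auto
  moreover have "?m \<in> ?U" using a by (simp add: coord_centre)
  ultimately obtain r where r: "r > 0" "ball ?m r \<subseteq> ?U" by (meson open_contains_ball)
  \<comment> \<open>The summand 1 covers the case that \<open>y\<close> is the centre itself.\<close>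
  define \<delta> where "\<delta> = min (1/2) (r / (2 * (1 + norm (y - ?m))))"
  have pos: "1 + norm (y - ?m) > 0" by (simp add: add_pos_nonneg)
  have \<delta>: "0 < \<delta>" "\<delta> < 1" using r pos by (auto simp: \<delta>_def)
  have "\<delta> * norm (y - ?m) \<le> r / (2 * (1 + norm (y - ?m))) * norm (y - ?m)"
    by (rule mult_right_mono) (auto simp: \<delta>_def)
  also have "\<dots> < r" using r(1) pos by (simp add: field_simps add_pos_nonneg)
  finally have "?m + \<delta> *\<^sub>R (y - ?m) \<in> ball ?m r" using \<delta> by (simp add: dist_norm)
  then have U: "?m + \<delta> *\<^sub>R (y - ?m) \<in> ?U" using r(2) by blast
  have ca: "coord a (?m + \<delta> *\<^sub>R (y - ?m)) = \<delta> * coord a y"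
  proof -
    have "coord a (?m + \<delta> *\<^sub>R (y - ?m)) = coord a ?m + \<delta> * (coord a y - coord a ?m)"
      by (simp add: coord_diff) (simp add: coord_def inner_add_right)
    then show ?thesis using coord_centre[OF a a] by simp
  qed
  have "0 \<le> coord v (?m + \<delta> *\<^sub>R (y - ?m))" if "v \<in> C" for v
    using that U ca y \<delta> by (cases "v = a") (auto intro: less_imp_le)
  then show ?thesis using that \<delta> ca by (simp add: hull_iff)
qed

text \<open>Otherwise a short segment from the centre of the common facet towards \<open>y\<close> would lie in both sets but
  not in the facet.\<close>

lemma opposite_side:
  assumes a: "a \<in> C" and K: "convex K" "convex hull C \<inter> K = face a" and y: "y \<in> K"
  shows "coord a y \<le> 0"
proof (rule ccontr)
  assume "\<not> coord a y \<le> 0"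
  then have pos: "coord a y > 0" by simp
  then obtain \<delta> where \<delta>: "0 < \<delta>" "\<delta> < 1" "facet_centre a + \<delta> *\<^sub>R (y - facet_centre a) \<in> convex hull C"
    "coord a (facet_centre a + \<delta> *\<^sub>R (y - facet_centre a)) = \<delta> * coord a y"
    using segment_from_centre[OF a, of y] by auto
  have "facet_centre a \<in> K" using centre_in_face[OF a] K(2) by blast
  then have "(1 - \<delta>) *\<^sub>R facet_centre a + \<delta> *\<^sub>R y \<in> K"
    using K(1) y \<delta> by (intro convexD_alt) auto
  then have "facet_centre a + \<delta> *\<^sub>R (y - facet_centre a) \<in> K" by (simp add: algebra_simps)
  then have "facet_centre a + \<delta> *\<^sub>R (y - facet_centre a) \<in> face a" using \<delta>(3) K(2) by blast
  then have "\<delta> * coord a y = 0" using face_iff[OF a] \<delta>(4) by auto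
  then show False using \<delta>(1) pos by simp
qed

text \<open>The centre lies strictly between any vertex of the facet distinct from it and some point of the
  simplex, so a face containing the centre contains these vertices.\<close>

lemma face_through_centre:
  assumes a: "a \<in> C" and X: "X face_of convex hull C" "facet_centre a \<in> X"
  shows "face a \<subseteq> X"
proof -
  have "c \<in> X" if c: "c \<in> C - {a}" for c
  proof (cases "c = facet_centre a")
    case False
    define y where "y = 2 *\<^sub>R facet_centre a - c"
    have "coord a y = 0"
    proof -
      have "coord a y = 2 * coord a (facet_centre a) - coord a c"
        by (simp add: y_def coord_def inner_diff_right)
      then show ?thesis using c a by (auto simp: coord_centre coord_vertex)
    qed
    then obtain \<delta> where \<delta>: "0 < \<delta>" "\<delta> < 1" "facet_centre a + \<delta> *\<^sub>R (y - facet_centre a) \<in> convex hull C"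
      using segment_from_centre[OF a, of y] by auto
    let ?z = "facet_centre a + \<delta> *\<^sub>R (y - facet_centre a)"
    have z: "?z = facet_centre a - \<delta> *\<^sub>R (c - facet_centre a)" by (simp add: y_def algebra_simps scaleR_2)
    have "facet_centre a = (1 - \<delta> / (1 + \<delta>)) *\<^sub>R ?z + (\<delta> / (1 + \<delta>)) *\<^sub>R c"
    proof -
      have 1: "1 - \<delta> / (1 + \<delta>) = 1 / (1 + \<delta>)" using \<delta> by (simp add: field_simps)
      have "(1 + \<delta>) *\<^sub>R ((1 / (1 + \<delta>)) *\<^sub>R ?z + (\<delta> / (1 + \<delta>)) *\<^sub>R c) = ?z + \<delta> *\<^sub>R c"
        using \<delta> by (simp add: scaleR_add_right)
      also have "\<dots> = (1 + \<delta>) *\<^sub>R facet_centre a" unfolding z by (simp add: algebra_simps)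
      finally show ?thesis unfolding 1 using \<delta> by (simp add: scaleR_cancel_left)
    qed
    moreover have "?z \<noteq> c"
    proof
      assume "?z = c"
      then have "(1 + \<delta>) *\<^sub>R (c - facet_centre a) = 0" unfolding z by (simp add: algebra_simps)
      then show False using \<delta> False by simp
    qed
    ultimately have "facet_centre a \<in> open_segment ?z c"
      using \<delta> unfolding in_segment by (intro conjI exI[of _ "\<delta> / (1 + \<delta>)"]) (auto simp: field_simps)
    then show ?thesis
      using face_ofD[OF X(1) _ _ _ X(2)] \<delta>(3) c by (metis Diff_iff hull_inc)
  qed (use X in simp)
  moreover have "convex X" using face_of_imp_convex[OF X(1)] .
  ultimately show ?thesis unfolding face_def by (intro hull_minimal) auto
qed

lemma face_inj: "\<lbrakk>a \<in> C; b \<in> C; face a = face b\<rbrakk> \<Longrightarrow> a = b"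
  using vertex_in_face[of a b] face_iff[of a a] coord_vertex[of a a] by auto

lemma facet_flux_diff:
  assumes a: "a \<in> C" and g: "continuous_on UNIV g" and h: "continuous_on UNIV h"
  shows "facet_flux a (\<lambda>x. g x - h x) = facet_flux a g - facet_flux a h"
proof -
  obtain b where b: "b \<in> C" "b \<noteq> a" by (rule other_vertex)
  have "integrable lborel (\<lambda>x. indicator {0..1} (coord a x) *
      (indicator (face a) (x - coord a x *\<^sub>R (a - b)) * k (x - coord a x *\<^sub>R (a - b))))"
    if "continuous_on UNIV k" for k :: "real^'d \<Rightarrow> real"
    by (rule integrable_on_prism[OF compact_face compact_Icc coord_continuous])
       (auto intro!: continuous_on_compose2[OF that] continuous_intros coord_continuous)
  from Bochner_Integration.integral_diff[OF this[OF g] this[OF h]] show ?thesis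
    by (simp add: facet_flux_eq[OF a b] g h continuous_on_diff right_diff_distrib)
qed

text \<open>The length of \<open>\<alpha> a\<close> cancels between the area of the facet and the unit normal.\<close>

lemma normal_integral_face:
  assumes a: "a \<in> C" and \<sigma>: "\<bar>\<sigma>\<bar> = 1" and F: "K \<inter> K' = face a"
    and side: "\<And>y. y \<in> K' \<Longrightarrow> 0 \<le> \<sigma> * coord a y" and off: "y0 \<in> K'" "coord a y0 \<noteq> 0"
  shows "normal_integral K K' = (\<sigma> * facet_flux a (\<lambda>x. 1)) *\<^sub>R \<alpha> a"
  using grad_nonzero[OF a]
  by (simp add: normal_integral_def F facet_measure_face(3)[OF a] inward_normal_face[OF a \<sigma> side off])

end

lemma barycentric_shift:
  assumes "barycentric C \<alpha> \<beta>"
  shows "barycentric ((+) z ` C) (\<lambda>v. \<alpha> (v - z)) (\<lambda>v. \<beta> (v - z) - \<alpha> (v - z) \<bullet> z)"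
proof -
  interpret barycentric C \<alpha> \<beta> by fact
  have inj: "inj_on ((+) z) C" by simp
  have c: "\<alpha> v \<bullet> x + (\<beta> v - \<alpha> v \<bullet> z) = coord v (x - z)" for v x
    by (simp add: coord_def inner_diff_right)
  show ?thesis
  proof
    show "card ((+) z ` C) = Suc CARD('a)" by (simp add: card_image[OF inj] card_C)
    show "(\<Sum>v\<in>(+) z ` C. \<alpha> (v - z) \<bullet> x + (\<beta> (v - z) - \<alpha> (v - z) \<bullet> z)) = 1" for x
      by (subst sum.reindex[OF inj]) (simp add: c coord_sum)
    show "(\<Sum>v\<in>(+) z ` C. (\<alpha> (v - z) \<bullet> x + (\<beta> (v - z) - \<alpha> (v - z) \<bullet> z)) *\<^sub>R v) = x" for x
      by (subst sum.reindex[OF inj])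
         (simp add: c scaleR_add_right sum.distrib scaleR_sum_left[symmetric] coord_sum coord_combination)
  qed (use finite_C in \<open>auto simp: c coord_vertex\<close>)
qed

text \<open>The hyperplane equation that \<open>facet_measure\<close> chooses for a translated facet need not be the
  translated equation, so the first identity goes through the formula \<open>facet_flux_eq\<close>.\<close>

lemma facet_flux_shift:
  assumes "barycentric C \<alpha> \<beta>" and a: "a \<in> C" and g: "continuous_on UNIV g"
  shows "barycentric.facet_flux ((+) z ` C) (\<lambda>v. \<alpha> (v - z)) (z + a) g
       = barycentric.facet_flux C \<alpha> a (\<lambda>x. g (x + z))"
    and "barycentric.face ((+) z ` C) (z + a) = (+) z ` barycentric.face C a"
    and "barycentric.coord (\<lambda>v. \<alpha> (v - z)) (\<lambda>v. \<beta> (v - z) - \<alpha> (v - z) \<bullet> z) (z + a) (x + z)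
       = barycentric.coord \<alpha> \<beta> a x"
proof -
  interpret barycentric C \<alpha> \<beta> by fact
  interpret z: barycentric "(+) z ` C" "\<lambda>v. \<alpha> (v - z)" "\<lambda>v. \<beta> (v - z) - \<alpha> (v - z) \<bullet> z"
    by (rule barycentric_shift) fact
  have "(+) z ` C - {z + a} = (+) z ` (C - {a})" by auto
  then show face: "z.face (z + a) = (+) z ` face a"
    by (simp add: z.face_def face_def convex_hull_translation)
  show coord: "z.coord (z + a) (x + z) = coord a x" for x
    by (simp add: z.coord_def coord_def inner_add_right)
  obtain b where b: "b \<in> C" "b \<noteq> a" by (rule other_vertex)
  have za: "z + a \<in> (+) z ` C" "z + b \<in> (+) z ` C" "z + b \<noteq> z + a" using a b by auto
  let ?h = "\<lambda>x. indicator {0..1} (z.coord (z + a) x) * (indicator (z.face (z + a)) (x - z.coord (z + a) x *\<^sub>R (a - b))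
      * g (x - z.coord (z + a) x *\<^sub>R (a - b)))"
  have "integrable lborel ?h"
    by (rule integrable_on_prism[OF z.compact_face compact_Icc z.coord_continuous])
       (auto intro!: continuous_on_compose2[OF g] continuous_intros z.coord_continuous)
  then have "?h \<in> borel_measurable borel" by auto
  from lborel_integral_shift[OF this, of z]
  have "z.facet_flux (z + a) g = (LINT x|lborel. ?h (x + z))"
    by (simp add: z.facet_flux_eq[OF za g])
  also have "\<dots> = facet_flux a (\<lambda>x. g (x + z))"
  proof -
    have "x + z - t *\<^sub>R (a - b) = (x - t *\<^sub>R (a - b)) + z" for x t by simp
    moreover have "continuous_on UNIV (\<lambda>x. g (x + z))"
      by (intro continuous_on_compose2[OF g] continuous_intros) auto
    ultimately show ?thesis by (simp only: facet_flux_eq[OF a b] coord face indicator_shift)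
  qed
  finally show "z.facet_flux (z + a) g = facet_flux a (\<lambda>x. g (x + z))" .
qed

text \<open>The dimensions of \<open>F\<close> and \<open>T\<close> differ by one, which leaves no room for a face in between.\<close>

lemma face_eq_facet:
  assumes "convex T" and F: "F facet_of T" and X: "X face_of T" "X \<noteq> T" "F \<subseteq> X"
  shows "X = F"
proof (rule ccontr)
  assume "X \<noteq> F"
  have "F face_of X" using F X by (meson face_of_subset facet_of_imp_face_of face_of_imp_subset)
  moreover have "convex X" using face_of_imp_convex[OF X(1)] .
  ultimately have "aff_dim F < aff_dim X" using \<open>X \<noteq> F\<close> face_of_aff_dim_lt by metis
  moreover have "aff_dim X < aff_dim T" using face_of_aff_dim_lt[OF assms(1) X(1,2)] .
  ultimately show False using F by (simp add: facet_of_def)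
qed

section \<open>Periodic simplicial meshes\<close>

lemma int_vecs_uminus: "z \<in> int_vecs \<Longrightarrow> - z \<in> int_vecs"
  by (auto simp: int_vecs_def)

lemma int_vecs_add: "\<lbrakk>y \<in> int_vecs; z \<in> int_vecs\<rbrakk> \<Longrightarrow> y + z \<in> int_vecs"
  by (auto simp: int_vecs_def)

lemma int_vecs_0: "0 \<in> int_vecs"
  by (auto simp: int_vecs_def)

lemma finite_bounded_int_vecs: "finite {z \<in> int_vecs :: (real^'d) set. \<forall>i. \<bar>z $ i\<bar> \<le> N}"
proof -
  have "{z \<in> int_vecs :: (real^'d) set. \<forall>i. \<bar>z $ i\<bar> \<le> N} \<subseteq> (\<lambda>f. \<chi> i. of_int (f i)) ` (\<Pi>\<^sub>E i\<in>UNIV. {-\<lceil>N\<rceil>..\<lceil>N\<rceil>})"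
  proof
    fix z :: "real^'d" assume z: "z \<in> {z \<in> int_vecs. \<forall>i. \<bar>z $ i\<bar> \<le> N}"
    have f: "of_int \<lfloor>z $ i\<rfloor> = z $ i" for i using z by (simp add: int_vecs_def)
    have "\<lfloor>z $ i\<rfloor> \<in> {-\<lceil>N\<rceil>..\<lceil>N\<rceil>}" for i
    proof -
      have "\<bar>of_int \<lfloor>z $ i\<rfloor>\<bar> \<le> (of_int \<lceil>N\<rceil> :: real)"
        using z f[of i] le_of_int_ceiling[of N] by (metis (mono_tags, lifting) mem_Collect_eq order_trans)
      then have "\<bar>\<lfloor>z $ i\<rfloor>\<bar> \<le> \<lceil>N\<rceil>" by linarith
      then show ?thesis by auto
    qed
    then show "z \<in> (\<lambda>f. \<chi> i. of_int (f i)) ` (\<Pi>\<^sub>E i\<in>UNIV. {-\<lceil>N\<rceil>..\<lceil>N\<rceil>})"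
      by (intro image_eqI[of _ _ "\<lambda>i. \<lfloor>z $ i\<rfloor>"]) (auto simp: vec_eq_iff f PiE_def extensional_def)
  qed
  then show ?thesis by (rule finite_subset) (intro finite_imageI finite_PiE, auto)
qed

locale mesh =
  fixes M :: "(real^'d) set set"
  assumes mesh: "periodic_simplicial_mesh M"
begin

lemma simplex: "T \<in> M \<Longrightarrow> int CARD('d) simplex T"
  and cover: "\<exists>T\<in>M. x \<in> T"
  and face: "\<lbrakk>T \<in> M; T' \<in> M\<rbrakk> \<Longrightarrow> (T \<inter> T') face_of T"
  and shift: "\<lbrakk>T \<in> M; z \<in> int_vecs\<rbrakk> \<Longrightarrow> (+) z ` T \<in> M"
  and finite_unit_box: "finite {T\<in>M. T \<inter> cbox 0 1 \<noteq> {}}"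
proof -
  note m = mesh[unfolded periodic_simplicial_mesh_def]
  show "T \<in> M \<Longrightarrow> int CARD('d) simplex T" using m by simp
  show "\<exists>T\<in>M. x \<in> T" using m by (metis UNIV_I UnionE)
  show "\<lbrakk>T \<in> M; T' \<in> M\<rbrakk> \<Longrightarrow> (T \<inter> T') face_of T" using m by simp
  show "\<lbrakk>T \<in> M; z \<in> int_vecs\<rbrakk> \<Longrightarrow> (+) z ` T \<in> M" using m by simp
  show "finite {T\<in>M. T \<inter> cbox 0 1 \<noteq> {}}" using m by simp
qed

lemma convex: "T \<in> M \<Longrightarrow> convex T" and compact: "T \<in> M \<Longrightarrow> compact T"
  and aff_dim: "T \<in> M \<Longrightarrow> aff_dim T = int CARD('d)"
  by (simp_all add: simplex convex_simplex[of "int CARD('d)"] compact_simplex[of "int CARD('d)"]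
      aff_dim_simplex[of "int CARD('d)"])

lemma measure_pos: assumes "T \<in> M" shows "0 < measure lborel T"
proof -
  obtain C \<alpha> \<beta> where C: "barycentric C \<alpha> \<beta>" "T = convex hull C"
    using simplex_barycentric[OF simplex[OF assms]] by metis
  then show ?thesis using barycentric.measure_simplex_pos by blast
qed

lemma shift_in_unit_box:
  assumes T: "T \<in> M" and x: "x \<in> T"
  shows "(+) (- (\<chi> i. of_int \<lfloor>x $ i\<rfloor>)) ` T \<in> {T\<in>M. T \<inter> cbox 0 1 \<noteq> {}}"
proof -
  let ?z = "(\<chi> i. of_int \<lfloor>x $ i\<rfloor>) :: real^'d"
  have "?z \<in> int_vecs" by (simp add: int_vecs_def)
  then have "(+) (- ?z) ` T \<in> M" using shift[OF T int_vecs_uminus] by blast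
  moreover have "- ?z + x \<in> cbox 0 1"
    by (auto simp: mem_box_cart) (linarith)+
  ultimately show ?thesis using x by blast
qed

text \<open>Every cell that meets \<open>B\<close> is the translate of a cell that meets the unit box, by one of finitely many
  integer vectors.\<close>

lemma locally_finite:
  assumes "bounded B" shows "finite {T\<in>M. T \<inter> B \<noteq> {}}"
proof -
  obtain N where N: "\<And>x. x \<in> B \<Longrightarrow> norm x \<le> N" using assms by (auto simp: bounded_iff)
  let ?Z = "{z \<in> int_vecs. \<forall>i. \<bar>z $ i\<bar> \<le> N + 1} :: (real^'d) set"
  let ?B = "{T\<in>M. T \<inter> cbox 0 1 \<noteq> {}}"
  have "{T\<in>M. T \<inter> B \<noteq> {}} \<subseteq> (\<lambda>(z, K). (+) z ` K) ` (?Z \<times> ?B)"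
  proof
    fix T assume "T \<in> {T\<in>M. T \<inter> B \<noteq> {}}"
    then obtain x where T: "T \<in> M" and x: "x \<in> T" "x \<in> B" by blast
    let ?z = "(\<chi> i. of_int \<lfloor>x $ i\<rfloor>) :: real^'d"
    have "\<bar>?z $ i\<bar> \<le> N + 1" for i
    proof -
      have "\<bar>x $ i\<bar> \<le> N" using N[OF x(2)] component_le_norm_cart[of x i] by linarith
      then show ?thesis by simp linarith
    qed
    then have "?z \<in> ?Z" by (simp add: int_vecs_def)
    moreover have "T = (+) ?z ` (+) (- ?z) ` T" by (simp add: image_image)
    ultimately show "T \<in> (\<lambda>(z, K). (+) z ` K) ` (?Z \<times> ?B)"
      using shift_in_unit_box[OF T x(1)] by (intro image_eqI[of _ _ "(?z, (+) (- ?z) ` T)"]) auto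
  qed
  then show ?thesis
    by (rule finite_subset) (intro finite_imageI finite_cartesian_product finite_bounded_int_vecs finite_unit_box)
qed

lemma neighbour_in_mesh: "T' \<in> neighbours M T \<Longrightarrow> T' \<in> M"
  by (simp add: neighbours_def)

lemma facet_sym:
  assumes "T \<in> M" "T' \<in> M" "(T \<inter> T') facet_of T" shows "(T \<inter> T') facet_of T'"
  using assms face[of T' T] aff_dim by (simp add: facet_of_def Int_commute)

lemma neighbours_sym: "\<lbrakk>T \<in> M; T' \<in> neighbours M T\<rbrakk> \<Longrightarrow> T \<in> neighbours M T'"
  using facet_sym by (auto simp: neighbours_def Int_commute)

lemma not_in_hyperplane:
  assumes "T \<in> M" "\<alpha> \<noteq> 0" obtains y where "y \<in> T" "\<alpha> \<bullet> y + \<beta> \<noteq> 0"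
proof (cases "T \<subseteq> {y. \<alpha> \<bullet> y = - \<beta>}")
  case True
  then have "aff_dim T \<le> int CARD('d) - 1"
    using aff_dim_subset[OF True] aff_dim_hyperplane[OF assms(2), of "- \<beta>"] by simp
  then show ?thesis using aff_dim[OF assms(1)] by simp
next
  case False
  then obtain y where "y \<in> T" "\<alpha> \<bullet> y \<noteq> - \<beta>" by blast
  then show ?thesis using that[of y] by (simp add: add_eq_0_iff2)
qed

lemma full_face_eq:
  assumes "T \<in> M" "T' \<in> M" "T \<inter> T' = T" shows "T = T'"
proof (rule ccontr)
  assume "T \<noteq> T'"
  moreover have "T face_of T'" using face[OF assms(2,1)] assms(3) by (simp add: Int_commute)
  ultimately have "aff_dim T < aff_dim T'" using face_of_aff_dim_lt convex[OF assms(2)] by blast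
  then show False using aff_dim assms by simp
qed

text \<open>Two cells on the same side of a common facet overlap in more than that facet, hence coincide.\<close>

lemma neighbour_across_facet_unique:
  assumes T: "T \<in> M" and N: "T1 \<in> neighbours M T" "T2 \<in> neighbours M T" and eq: "T \<inter> T1 = T \<inter> T2"
  shows "T1 = T2"
proof -
  have M: "T1 \<in> M" "T2 \<in> M" using N neighbour_in_mesh by auto
  obtain C \<alpha> \<beta> where C: "barycentric C \<alpha> \<beta>" "T = convex hull C" "\<not> affine_dependent C"
    using simplex_barycentric[OF simplex[OF T]] by metis
  interpret barycentric C \<alpha> \<beta> by fact
  have F: "(T \<inter> T1) facet_of T" using N(1) by (simp add: neighbours_def)
  then obtain a where a: "a \<in> C" "T \<inter> T1 = face a" using facet_iff[OF C(3)] C(2) by auto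
  obtain C1 \<alpha>1 \<beta>1 where C1: "barycentric C1 \<alpha>1 \<beta>1" "T1 = convex hull C1" "\<not> affine_dependent C1"
    using simplex_barycentric[OF simplex[OF M(1)]] by metis
  interpret c1: barycentric C1 \<alpha>1 \<beta>1 by fact
  have F1: "(T \<inter> T1) facet_of T1" using facet_sym[OF T M(1) F] .
  then obtain a1 where a1: "a1 \<in> C1" "T \<inter> T1 = c1.face a1" using c1.facet_iff[OF C1(3)] C1(2) by auto
  have side: "coord a y \<le> 0" if "y \<in> T1 \<or> y \<in> T2" for y
    using that opposite_side[OF a(1)] a(2) eq C(2) convex M by metis
  have "c1.face a1 \<subseteq> {x. \<alpha> a \<bullet> x = - \<beta> a}"
    using a a1 face_iff[OF a(1)] by (auto simp: coord_def)
  then obtain \<kappa> where \<kappa>: "\<And>x. \<alpha> a \<bullet> x - (- \<beta> a) = \<kappa> * c1.coord a1 x"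
    using c1.normal_of_face[OF a1(1)] by metis
  then have \<kappa>: "coord a x = \<kappa> * c1.coord a1 x" for x by (simp add: coord_def)
  have "\<kappa> < 0"
  proof -
    obtain y where y: "y \<in> T1" "\<alpha> a \<bullet> y + \<beta> a \<noteq> 0" using not_in_hyperplane[OF M(1) grad_nonzero[OF a(1)]] by blast
    then have "coord a y < 0" using side[of y] by (auto simp: coord_def)
    moreover have "c1.coord a1 y \<ge> 0" using y(1) a1(1) C1(2) c1.hull_iff by blast
    ultimately show ?thesis by (simp add: \<kappa> mult_less_0_iff)
  qed
  obtain y where y: "y \<in> T2" "\<alpha> a \<bullet> y + \<beta> a \<noteq> 0" using not_in_hyperplane[OF M(2) grad_nonzero[OF a(1)]] by blast
  have "coord a y < 0" using y side[of y] by (auto simp: coord_def)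
  then have pos: "c1.coord a1 y > 0" using \<open>\<kappa> < 0\<close> by (simp add: \<kappa> mult_less_0_iff)
  then have "T1 \<inter> T2 \<noteq> T \<inter> T1"
    using c1.opposite_side[OF a1(1) convex[OF M(2)] _ y(1)] C1(2) a1(2) by auto
  moreover have "T \<inter> T1 \<subseteq> T1 \<inter> T2" using eq by blast
  ultimately have "T1 \<inter> T2 = T1"
    using face_eq_facet[OF convex[OF M(1)] F1 face[OF M]] by blast
  then show ?thesis using full_face_eq M by blast
qed

text \<open>Points just outside a facet, approaching its barycentre, lie in finitely many cells, so one cell
  contains infinitely many of them and, being closed, the barycentre as well.\<close>

lemma neighbour_across_facet_exists:
  assumes T: "T \<in> M" and F: "F facet_of T"
  obtains T' where "T' \<in> neighbours M T" "T \<inter> T' = F"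
proof -
  obtain C \<alpha> \<beta> where C: "barycentric C \<alpha> \<beta>" "T = convex hull C" "\<not> affine_dependent C"
    using simplex_barycentric[OF simplex[OF T]] by metis
  interpret barycentric C \<alpha> \<beta> by fact
  obtain a where a: "a \<in> C" "F = face a" using facet_iff[OF C(3)] C(2) F by auto
  obtain b where b: "b \<in> C" "b \<noteq> a" by (rule other_vertex)
  define x where "x n = facet_centre a + (- inverse (real (Suc n))) *\<^sub>R (a - b)" for n
  have lim: "x \<longlonglongrightarrow> facet_centre a"
  proof -
    have "x \<longlonglongrightarrow> facet_centre a + (- 0) *\<^sub>R (a - b)" unfolding x_def
      by (intro tendsto_intros LIMSEQ_inverse_real_of_nat)
    then show ?thesis by simp
  qed
  have outside: "x n \<notin> T" for n
  proof
    assume "x n \<in> T"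
    then have "0 \<le> coord a (x n)" using C(2) a(1) hull_iff by blast
    also have "coord a (x n) = coord a (facet_centre a) + - inverse (real (Suc n)) * (1 - (if a = b then 1 else 0))"
      using coord_along_edge[OF a(1) b(1) a(1)] by (simp only: x_def simp_thms if_True)
    also have "\<dots> = - inverse (real (Suc n))" using b(2) coord_centre[OF a(1) a(1)] by simp
    finally show False by simp
  qed
  have "\<forall>n. \<exists>K. K \<in> M \<and> x n \<in> K" using cover by blast
  then obtain K where K: "\<And>n. K n \<in> M" "\<And>n. x n \<in> K n" by metis
  have "bounded (range x)" by (rule convergent_imp_bounded[OF lim])
  then have "finite {T\<in>M. T \<inter> range x \<noteq> {}}" by (rule locally_finite)
  moreover have "range K \<subseteq> {T\<in>M. T \<inter> range x \<noteq> {}}" using K by blast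
  ultimately have "finite (range K)" by (rule finite_subset[rotated])
  then obtain k where inf: "infinite {n. K n = K k}"
    using pigeonhole_infinite[of "UNIV :: nat set" K] by auto
  define T' where "T' = K k"
  have T': "T' \<in> M" using K by (simp add: T'_def)
  have often: "\<exists>n\<ge>m. x n \<in> T'" for m
  proof -
    obtain n where "n \<ge> m" "K n = K k" using inf unfolding infinite_nat_iff_unbounded_le by blast
    then show ?thesis using K(2)[of n] by (auto simp: T'_def)
  qed
  have "facet_centre a \<in> T'"
  proof (rule ccontr)
    assume "facet_centre a \<notin> T'"
    moreover have "open (- T')" using compact[OF T'] by (simp add: compact_imp_closed open_Compl)
    ultimately have "\<forall>\<^sub>F n in sequentially. x n \<in> - T'"
      using topological_tendstoD[OF lim, of "- T'"] by simp
    then obtain m where "\<And>n. n \<ge> m \<Longrightarrow> x n \<in> - T'" by (auto simp: eventually_sequentially)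
    then show False using often[of m] by blast
  qed
  moreover have "facet_centre a \<in> T" using centre_in_face[OF a(1)] face_iff[OF a(1)] C(2) by blast
  ultimately have sub: "F \<subseteq> T \<inter> T'"
    using face_through_centre[OF a(1), of "T \<inter> T'"] face[OF T T'] C(2) a(2) by blast
  have "T \<inter> T' \<noteq> T" using full_face_eq[OF T T'] often[of 0] outside by blast
  then have eq: "T \<inter> T' = F" using face_eq_facet[OF convex[OF T] F face[OF T T']] sub by blast
  then have "T' \<in> neighbours M T" using F T' by (simp add: neighbours_def)
  then show ?thesis using that eq by blast
qed

text \<open>A neighbour lies on the other side of the common facet, so the two normals are opposite multiples
  of the same gradient.\<close>

lemma neighbour_barycentric:
  assumes T: "T \<in> M" and T': "T' \<in> neighbours M T"
    and C: "barycentric C \<alpha> \<beta>" "T = convex hull C" "\<not> affine_dependent C"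
  obtains a where "a \<in> C" "T \<inter> T' = barycentric.face C a"
    "\<And>g. face_avg (T \<inter> T') g = barycentric.facet_flux C \<alpha> a g / barycentric.facet_flux C \<alpha> a (\<lambda>x. 1)"
    "normal_integral T T' = - barycentric.facet_flux C \<alpha> a (\<lambda>x. 1) *\<^sub>R \<alpha> a"
    "normal_integral T' T = barycentric.facet_flux C \<alpha> a (\<lambda>x. 1) *\<^sub>R \<alpha> a"
proof -
  interpret barycentric C \<alpha> \<beta> by fact
  have M': "T' \<in> M" using neighbour_in_mesh[OF T'] .
  have "(T \<inter> T') facet_of T" using T' by (simp add: neighbours_def)
  then obtain a where a: "a \<in> C" "T \<inter> T' = face a" using facet_iff[OF C(3)] C(2) by auto
  have side': "0 \<le> -1 * coord a y" if "y \<in> T'" for y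
    using opposite_side[OF a(1) convex[OF M'] _ that] a(2) C(2) by simp
  have side: "0 \<le> 1 * coord a y" if "y \<in> T" for y using that C(2) hull_iff a(1) by simp
  obtain y' where y': "y' \<in> T'" "coord a y' \<noteq> 0"
    using not_in_hyperplane[OF M' grad_nonzero[OF a(1)]] by (metis coord_def)
  obtain y where y: "y \<in> T" "coord a y \<noteq> 0"
    using not_in_hyperplane[OF T grad_nonzero[OF a(1)]] by (metis coord_def)
  have "normal_integral T T' = (-1 * facet_flux a (\<lambda>x. 1)) *\<^sub>R \<alpha> a"
    by (rule normal_integral_face[OF a(1) _ a(2) side' y']) auto
  moreover have "normal_integral T' T = (1 * facet_flux a (\<lambda>x. 1)) *\<^sub>R \<alpha> a"
    using a(2) by (intro normal_integral_face[OF a(1) _ _ side y]) auto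
  moreover have "face_avg (T \<inter> T') g = facet_flux a g / facet_flux a (\<lambda>x. 1)" for g
    unfolding a(2) by (rule facet_measure_face(2)[OF a(1)])
  ultimately show ?thesis using that[of a] a by simp
qed

lemma normal_integral_sym:
  assumes T: "T \<in> M" and T': "T' \<in> neighbours M T"
  shows "normal_integral T' T = - normal_integral T T'"
proof -
  obtain C \<alpha> \<beta> where C: "barycentric C \<alpha> \<beta>" "T = convex hull C" "\<not> affine_dependent C"
    using simplex_barycentric[OF simplex[OF T]] by metis
  show ?thesis by (rule neighbour_barycentric[OF T T' C]) simp
qed

lemma face_avg_diff:
  assumes T: "T \<in> M" and T': "T' \<in> neighbours M T" and "continuous_on UNIV g" "continuous_on UNIV h"
  shows "face_avg (T \<inter> T') (\<lambda>x. g x - h x) = face_avg (T \<inter> T') g - face_avg (T \<inter> T') h"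
proof -
  obtain C \<alpha> \<beta> where C: "barycentric C \<alpha> \<beta>" "T = convex hull C" "\<not> affine_dependent C"
    using simplex_barycentric[OF simplex[OF T]] by metis
  interpret barycentric C \<alpha> \<beta> by fact
  obtain a where "a \<in> C" "\<And>g. face_avg (T \<inter> T') g = facet_flux a g / facet_flux a (\<lambda>x. 1)"
    using neighbour_barycentric[OF T T' C] by metis
  then show ?thesis using facet_flux_diff assms by (simp add: diff_divide_distrib)
qed

lemma neighbours_shift:
  assumes "T \<in> M" "T' \<in> neighbours M T" "z \<in> int_vecs"
  shows "(+) z ` T' \<in> neighbours M ((+) z ` T)"
proof -
  have "(+) z ` T \<inter> (+) z ` T' = (+) z ` (T \<inter> T')" by auto
  then show ?thesis using assms shift
    by (simp add: neighbours_def facet_of_def aff_dim_translation_eq)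
qed

lemma face_avg_normal_integral_shift:
  assumes T: "T \<in> M" and T': "T' \<in> neighbours M T" and z: "z \<in> int_vecs" and g: "continuous_on UNIV g"
  shows "face_avg ((+) z ` T \<inter> (+) z ` T') g = face_avg (T \<inter> T') (\<lambda>x. g (x + z))"
    and "normal_integral ((+) z ` T) ((+) z ` T') = normal_integral T T'"
proof -
  obtain C \<alpha> \<beta> where C: "barycentric C \<alpha> \<beta>" "T = convex hull C" "\<not> affine_dependent C"
    using simplex_barycentric[OF simplex[OF T]] by metis
  interpret barycentric C \<alpha> \<beta> by fact
  interpret z: barycentric "(+) z ` C" "\<lambda>v. \<alpha> (v - z)" "\<lambda>v. \<beta> (v - z) - \<alpha> (v - z) \<bullet> z"
    by (rule barycentric_shift) fact
  obtain a where a: "a \<in> C" "T \<inter> T' = face a"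
      "\<And>g. face_avg (T \<inter> T') g = facet_flux a g / facet_flux a (\<lambda>x. 1)"
      "normal_integral T T' = - facet_flux a (\<lambda>x. 1) *\<^sub>R \<alpha> a"
    using neighbour_barycentric[OF T T' C] by metis
  have "(+) z ` T = convex hull ((+) z ` C)" "\<not> affine_dependent ((+) z ` C)"
    using C affine_dependent_translation_eq[of C z] by (simp_all add: convex_hull_translation)
  from neighbour_barycentric[OF shift[OF T z] neighbours_shift[OF T T' z] z.barycentric_axioms this]
  obtain a' where a': "a' \<in> (+) z ` C" "(+) z ` T \<inter> (+) z ` T' = z.face a'"
      "\<And>g. face_avg ((+) z ` T \<inter> (+) z ` T') g = z.facet_flux a' g / z.facet_flux a' (\<lambda>x. 1)"
      "normal_integral ((+) z ` T) ((+) z ` T') = - z.facet_flux a' (\<lambda>x. 1) *\<^sub>R \<alpha> (a' - z)"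
    by metis
  have "(+) z ` T \<inter> (+) z ` T' = (+) z ` (T \<inter> T')" by auto
  then have "z.face a' = (+) z ` (T \<inter> T')" using a'(2) by simp
  also have "\<dots> = z.face (z + a)" using facet_flux_shift(2)[OF C(1) a(1) g] a(2) by simp
  finally have eq: "a' = z + a" using a(1) a'(1) by (intro z.face_inj) auto
  note fs = facet_flux_shift(1)[OF C(1) a(1)]
  show "face_avg ((+) z ` T \<inter> (+) z ` T') g = face_avg (T \<inter> T') (\<lambda>x. g (x + z))"
    by (simp add: a'(3) a(3) eq fs[OF g] fs[OF continuous_on_const])
  show "normal_integral ((+) z ` T) ((+) z ` T') = normal_integral T T'"
    by (simp add: a'(4) a(4) eq fs[OF continuous_on_const])
qed

text \<open>The neighbours of a cell correspond one to one to its facets.\<close>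

lemma divergence_theorem_cell:
  assumes T: "T \<in> M" and g: "has_continuous_gradient g G"
  shows "finite (neighbours M T)"
    and "(\<Sum>T'\<in>neighbours M T. face_avg (T \<inter> T') g *\<^sub>R normal_integral T T') = (LINT x:T|lborel. G x)"
proof -
  obtain C \<alpha> \<beta> where C: "barycentric C \<alpha> \<beta>" "T = convex hull C" "\<not> affine_dependent C"
    using simplex_barycentric[OF simplex[OF T]] by metis
  interpret barycentric C \<alpha> \<beta> by fact
  have "\<exists>T'. T' \<in> neighbours M T \<and> T \<inter> T' = face a" if "a \<in> C" for a
    using neighbour_across_facet_exists[OF T] facet_iff[OF C(3)] C(2) that by metis
  then obtain nb where nb: "\<And>a. a \<in> C \<Longrightarrow> nb a \<in> neighbours M T" "\<And>a. a \<in> C \<Longrightarrow> T \<inter> nb a = face a"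
    by metis
  have bij: "bij_betw nb C (neighbours M T)"
    unfolding bij_betw_def
  proof (intro conjI inj_onI equalityI subsetI)
    fix a b assume "a \<in> C" "b \<in> C" "nb a = nb b"
    then show "a = b" using nb(2) face_inj by metis
  next
    fix T' assume T': "T' \<in> neighbours M T"
    then obtain a where a: "a \<in> C" "T \<inter> T' = face a"
      using facet_iff[OF C(3)] C(2) by (auto simp: neighbours_def)
    then have "nb a = T'" using neighbour_across_facet_unique[OF T nb(1)[OF a(1)] T'] nb(2) by simp
    then show "T' \<in> nb ` C" using a(1) by blast
  qed (use nb in auto)
  then show "finite (neighbours M T)" using finite_C bij_betw_finite by blast
  have "face_avg (T \<inter> nb a) g *\<^sub>R normal_integral T (nb a) = - (facet_flux a g *\<^sub>R \<alpha> a)" if a: "a \<in> C" for a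
  proof -
    obtain a' where a': "a' \<in> C" "T \<inter> nb a = face a'"
      "\<And>g. face_avg (T \<inter> nb a) g = facet_flux a' g / facet_flux a' (\<lambda>x. 1)"
      "normal_integral T (nb a) = - facet_flux a' (\<lambda>x. 1) *\<^sub>R \<alpha> a'"
      using neighbour_barycentric[OF T nb(1)[OF a] C] by metis
    have "a' = a" using a' nb(2)[OF a] face_inj a by metis
    then show ?thesis using a'(3,4) facet_flux_1_pos[OF a] by simp
  qed
  then have "(\<Sum>T'\<in>neighbours M T. face_avg (T \<inter> T') g *\<^sub>R normal_integral T T') = - (\<Sum>a\<in>C. facet_flux a g *\<^sub>R \<alpha> a)"
    by (subst sum.reindex_bij_betw[OF bij, symmetric]) (simp add: sum_negf[symmetric])
  then show "(\<Sum>T'\<in>neighbours M T. face_avg (T \<inter> T') g *\<^sub>R normal_integral T T') = (LINT x:T|lborel. G x)"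
    using divergence_theorem_simplex[OF g] C(2) by simp
qed

section \<open>Summation over one period\<close>

lemma equiv_translation: "equiv M (translation_rel M)"
proof (rule equivI)
  show "translation_rel M \<subseteq> M \<times> M" by (auto simp: translation_rel_def)
  show "refl_on M (translation_rel M)"
    by (auto simp: refl_on_def translation_rel_def intro!: bexI[of _ 0] int_vecs_0)
  show "sym (translation_rel M)"
  proof (rule symI)
    fix T T' assume "(T, T') \<in> translation_rel M"
    then obtain z where z: "T \<in> M" "T' \<in> M" "z \<in> int_vecs" "T' = (+) z ` T" by (auto simp: translation_rel_def)
    then have "T = (+) (- z) ` T'" by (simp add: image_image)
    then show "(T', T) \<in> translation_rel M"
      unfolding translation_rel_def using z(1,2) int_vecs_uminus[OF z(3)] by blast
  qed
  show "trans (translation_rel M)"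
  proof (rule transI)
    fix T T' T'' assume "(T, T') \<in> translation_rel M" "(T', T'') \<in> translation_rel M"
    then obtain y z where yz: "T \<in> M" "T'' \<in> M" "y \<in> int_vecs" "z \<in> int_vecs" "T'' = (+) z ` (+) y ` T"
      unfolding translation_rel_def by blast
    then have "T'' = (+) (z + y) ` T" by (simp add: image_image add.assoc)
    then show "(T, T'') \<in> translation_rel M"
      unfolding translation_rel_def using yz int_vecs_add[OF yz(4,3)] by blast
  qed
qed

text \<open>A nonzero translation \<open>e\<close> would raise the maximum of \<open>x \<mapsto> e \<bullet> x\<close> over the compact cell.\<close>

lemma shift_unique:
  assumes T: "T \<in> M" and eq: "(+) y ` T = (+) z ` T" shows "y = z"
proof -
  define e where "e = z - y"
  have "T \<noteq> {}" using aff_dim[OF T] aff_dim_empty[of T] by force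
  moreover have "continuous_on T (\<lambda>x. e \<bullet> x)" by (intro continuous_intros)
  ultimately obtain x where x: "x \<in> T" "\<forall>x'\<in>T. e \<bullet> x' \<le> e \<bullet> x"
    using continuous_attains_sup[OF compact[OF T], of "\<lambda>x. e \<bullet> x"] by blast
  have "z + x \<in> (+) y ` T" using x(1) eq by blast
  then obtain x' where "x' \<in> T" "z + x = y + x'" by blast
  then have "x + e \<in> T" by (simp add: e_def algebra_simps)
  with x(2) have "e \<bullet> (x + e) \<le> e \<bullet> x" by blast
  then have "e \<bullet> e \<le> 0" by (simp add: inner_add_right)
  then have "e = 0" by (metis inner_ge_zero inner_eq_zero_iff order_antisym)
  then show ?thesis by (simp add: e_def)
qed

text \<open>Each facet modulo translations is counted once from either side. The involution that matches the
  two occurrences passes to the neighbour and translates the pair back to the representative of its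
  class.\<close>

lemma antisymmetric_periodic_sum:
  fixes \<Phi> :: "(real^'d) set \<Rightarrow> (real^'d) set \<Rightarrow> 'v::real_vector"
  assumes anti: "\<And>T T'. \<lbrakk>T \<in> M; T' \<in> neighbours M T\<rbrakk> \<Longrightarrow> \<Phi> T' T = - \<Phi> T T'"
    and periodic: "\<And>T T' z. \<lbrakk>T \<in> M; T' \<in> neighbours M T; z \<in> int_vecs\<rbrakk> \<Longrightarrow> \<Phi> ((+) z ` T) ((+) z ` T') = \<Phi> T T'"
    and rep: "\<And>c. c \<in> elements_mod_translations M \<Longrightarrow> rep c \<in> c"
  shows "(\<Sum>c\<in>elements_mod_translations M. \<Sum>T'\<in>neighbours M (rep c). \<Phi> (rep c) T') = 0"
proof (cases "finite (elements_mod_translations M)")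
  case True
  let ?E = "elements_mod_translations M" and ?R = "translation_rel M"
  define P where "P = (SIGMA c:?E. neighbours M (rep c))"
  define cls where "cls T = ?R `` {T}" for T
  define sh where "sh T = (SOME z. z \<in> int_vecs \<and> T = (+) z ` rep (cls T))" for T
  define \<phi> where "\<phi> = (\<lambda>(c, T'). (cls T', (+) (- sh T') ` rep c))"
  have cls: "cls T \<in> ?E" if "T \<in> M" for T using that by (simp add: cls_def quotientI)
  have repM: "rep c \<in> M" and cls_rep: "cls (rep c) = c" if "c \<in> ?E" for c
  proof -
    show "rep c \<in> M" using rep[OF that] that equiv_translation in_quotient_imp_subset by blast
    show "cls (rep c) = c"
      using rep[OF that] that equiv_translation unfolding cls_def
      by (metis Image_singleton_iff equiv_class_eq quotientE)
  qed
  have cls_shift: "cls ((+) z ` T) = cls T" if "T \<in> M" "z \<in> int_vecs" for T z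
    unfolding cls_def
    by (rule equiv_class_eq[OF equiv_translation, symmetric])
       (use that shift in \<open>auto simp: translation_rel_def\<close>)
  have sh: "sh T \<in> int_vecs \<and> T = (+) (sh T) ` rep (cls T)" if T: "T \<in> M" for T
  proof -
    have "rep (cls T) \<in> ?R `` {T}" using rep[OF cls[OF T]] unfolding cls_def .
    then have "(rep (cls T), T) \<in> ?R"
      using equiv_translation by (meson Image_singleton_iff equivE symD)
    then have "\<exists>z. z \<in> int_vecs \<and> T = (+) z ` rep (cls T)" by (auto simp: translation_rel_def)
    then show ?thesis unfolding sh_def by (rule someI_ex)
  qed
  have *: "\<phi> x \<in> P \<and> \<phi> (\<phi> x) = x \<and> (case \<phi> x of (c, T') \<Rightarrow> \<Phi> (rep c) T') = - (case x of (c, T') \<Rightarrow> \<Phi> (rep c) T')"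
    if xP: "x \<in> P" for x
  proof -
    obtain c T' where x: "x = (c, T')" "c \<in> ?E" "T' \<in> neighbours M (rep c)"
      using xP unfolding P_def by blast
    define z where "z = sh T'"
    have T': "T' \<in> M" using x(3) by (rule neighbour_in_mesh)
    have z: "z \<in> int_vecs" "T' = (+) z ` rep (cls T')" "- z \<in> int_vecs"
      using sh[OF T'] int_vecs_uminus by (auto simp: z_def)
    have "(+) (- z) ` (+) z ` rep (cls T') = rep (cls T')" by (simp add: image_image)
    then have to_rep: "(+) (- z) ` T' = rep (cls T')" using z(2) by metis
    have sym: "rep c \<in> neighbours M T'" by (rule neighbours_sym[OF repM[OF x(2)] x(3)])
    have \<phi>x: "\<phi> x = (cls T', (+) (- z) ` rep c)" by (simp add: \<phi>_def x(1) z_def)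
    have nb: "(+) (- z) ` rep c \<in> neighbours M (rep (cls T'))"
      using neighbours_shift[OF T' sym z(3)] to_rep by simp
    then have "\<phi> x \<in> P" using cls[OF T'] by (simp add: P_def \<phi>x)
    moreover have "\<phi> (\<phi> x) = x"
    proof -
      have inM: "(+) (- z) ` rep c \<in> M" using nb neighbour_in_mesh by blast
      have c: "cls ((+) (- z) ` rep c) = c" using cls_shift[OF repM[OF x(2)] z(3)] cls_rep[OF x(2)] by simp
      have "sh ((+) (- z) ` rep c) = - z"
        using sh[OF inM] c shift_unique[OF repM[OF x(2)]] by metis
      then have "\<phi> (cls T', (+) (- z) ` rep c) = (c, (+) z ` rep (cls T'))"
        by (simp only: \<phi>_def prod.case c minus_minus)
      then show ?thesis unfolding \<phi>x by (simp only: x(1) z(2)[symmetric])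
    qed
    moreover have "(case \<phi> x of (c, T') \<Rightarrow> \<Phi> (rep c) T') = - (case x of (c, T') \<Rightarrow> \<Phi> (rep c) T')"
      unfolding \<phi>x unfolding x(1) prod.case
    proof -
      have "\<Phi> (rep (cls T')) ((+) (- z) ` rep c) = \<Phi> T' (rep c)"
        using periodic[OF T' sym z(3)] by (simp only: to_rep)
      also have "\<dots> = - \<Phi> (rep c) T'" by (rule anti[OF repM[OF x(2)] x(3)])
      finally show "\<Phi> (rep (cls T')) ((+) (- z) ` rep c) = - \<Phi> (rep c) T'" .
    qed
    ultimately show ?thesis by blast
  qed
  have fin: "finite (neighbours M (rep c))" if "c \<in> ?E" for c
    by (rule divergence_theorem_cell(1)[OF repM[OF that] has_continuous_gradient_const])
  define s where "s = (\<Sum>x\<in>P. case x of (c, T') \<Rightarrow> \<Phi> (rep c) T')"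
  have "s = (\<Sum>x\<in>P. - (case x of (c, T') \<Rightarrow> \<Phi> (rep c) T'))"
    unfolding s_def by (rule sum.reindex_bij_witness[of _ \<phi> \<phi>]) (simp_all add: *)
  also have "\<dots> = - s" unfolding s_def by (rule sum_negf)
  finally have "s + s = 0" by (metis add.right_inverse)
  then have "2 *\<^sub>R s = 0" by (simp only: scaleR_2)
  then have "s = 0" by simp
  then show ?thesis using True fin by (simp add: s_def P_def sum.Sigma)
qed simp

end

section \<open>The truncation error on polynomials\<close>

text \<open>Negating the diagonal factor turns the diagonalizations of \<open>B\<close> into those of \<open>- B\<close> and keeps the
  absolute values, so both sides are defined by the same description.\<close>

lemma matrix_abs_uminus: "matrix_abs (- B) = matrix_abs (B :: real^'n^'n)"
proof -
  have neg: "- (X ** D ** Y) = X ** (- D) ** Y" for X D Y :: "real^'n^'n"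
    by (simp add: vec_eq_iff matrix_matrix_mult_def sum_negf)
  let ?P = "\<lambda>B C. \<exists>S D :: real^'n^'n. invertible S \<and> diagonal_mat D \<and> B = S ** D ** matrix_inv S \<and>
      C = S ** (\<chi> i j. \<bar>D $ i $ j\<bar>) ** matrix_inv S"
  have imp: "?P (- B) C" if P: "?P B C" for B C :: "real^'n^'n"
  proof -
    obtain S D :: "real^'n^'n" where SD: "invertible S" "diagonal_mat D" "B = S ** D ** matrix_inv S"
      "C = S ** (\<chi> i j. \<bar>D $ i $ j\<bar>) ** matrix_inv S"
      using P by blast
    then show ?thesis
      by (intro exI[of _ S] exI[of _ "- D"]) (simp add: neg diagonal_mat_def)
  qed
  have "?P (- B) C = ?P B C" for C using imp[of B C] imp[of "- B" C] by (simp only: minus_minus) blast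
  then show ?thesis unfolding matrix_abs_def by simp
qed

lemma mat_dot_uminus: "mat_dot A (- n) = - mat_dot A n"
  by (simp add: mat_dot_def sum_negf)

lemma mat_dot_mult_component: "(mat_dot A n *v y) $ k = (\<Sum>i\<in>UNIV. \<Sum>l\<in>UNIV. A i $ k $ l * (y $ l * n $ i))"
proof -
  have "(mat_dot A n *v y) $ k = (\<Sum>l\<in>UNIV. \<Sum>i\<in>UNIV. A i $ k $ l * (y $ l * n $ i))"
    by (simp add: mat_dot_def matrix_vector_mult_def sum_distrib_left sum_distrib_right mult_ac)
  then show ?thesis by (subst sum.swap)
qed

lemma set_integral_vec_nth:
  fixes f :: "'a \<Rightarrow> real^'n"
  assumes "set_integrable M A f"
  shows "(LINT x:A|M. f x) $ k = (LINT x:A|M. f x $ k)"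
  using integral_bounded_linear[OF bounded_linear_vec_nth, of M "\<lambda>x. indicator A x *\<^sub>R f x" k] assms
  by (simp add: set_lebesgue_integral_def set_integrable_def)

lemma cell_avg_vec_nth:
  fixes f :: "real^'d \<Rightarrow> real^'n"
  assumes "compact K" "continuous_on UNIV f"
  shows "cell_avg K f $ k = cell_avg K (\<lambda>x. f x $ k)"
  by (simp add: cell_avg_def set_integral_vec_nth[OF compact_set_integrable[OF assms]])

locale scheme = mesh M for M :: "(real^'d) set set" +
  fixes p :: nat and A :: "'d \<Rightarrow> real^'n^'n" and S :: "'d stencils" and w :: "'d weights"
    and f :: "real^'d \<Rightarrow> real^'n"
  assumes admissible: "admissible_stencils p M S w" and f_poly: "f \<in> poly_vecs (Suc p)"
begin

lemma component_poly: "(\<lambda>x. f x $ i) \<in> polys (Suc p)"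
  using f_poly by (simp add: poly_vecs_def)

lemma f_continuous: "continuous_on UNIV f"
proof -
  have "continuous_on UNIV (\<lambda>x. \<chi> i. f x $ i)"
    by (intro continuous_on_vec_lambda polys_continuous[OF component_poly])
  then show ?thesis by simp
qed

lemma stencil_in_mesh: "\<lbrakk>T \<in> M; K \<in> S T\<rbrakk> \<Longrightarrow> K \<in> M"
  using admissible by (auto simp: admissible_stencils_def)

lemma stencil: assumes T: "T \<in> M" shows "stencil p S w T"
proof
  have a: "finite (S T)" "T \<in> S T" "\<forall>K\<in>S T. 0 < w T K"
    "\<forall>q\<in>polys p. (\<forall>K\<in>S T. cell_avg K q = 0) \<longrightarrow> q = (\<lambda>x. 0)"
    using admissible T unfolding admissible_stencils_def by simp_all
  show "finite (S T)" "T \<in> S T" using a by simp_all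
  show "0 < w T K" "compact K" "0 < measure lborel K" if "K \<in> S T" for K
    using a(3) that compact[OF stencil_in_mesh[OF T that]] measure_pos[OF stencil_in_mesh[OF T that]] by simp_all
  show "q = (\<lambda>x. 0)" if "q \<in> polys p" "\<And>K. K \<in> S T \<Longrightarrow> cell_avg K q = 0" for q
    using a(4) that by simp
qed

definition recon :: "(real^'d) set \<Rightarrow> 'n \<Rightarrow> real^'d \<Rightarrow> real" where
  "recon T i = reconstruction p S w T (\<lambda>K. cell_projection f K $ i)"

definition residual :: "(real^'d) set \<Rightarrow> 'n \<Rightarrow> real^'d \<Rightarrow> real" where
  "residual T i = (\<lambda>x. f x $ i - recon T i x)"

lemma recon_continuous: "T \<in> M \<Longrightarrow> continuous_on X (recon T i)"
  unfolding recon_def by (rule polys_continuous[OF stencil.reconstruction_in_polys[OF stencil]])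

lemma residual_continuous: "T \<in> M \<Longrightarrow> continuous_on UNIV (residual T i)"
  unfolding residual_def
  by (intro continuous_on_diff recon_continuous polys_continuous[OF component_poly])

text \<open>A translation by \<open>z\<close> changes \<open>f\<close> only by a polynomial of degree \<open>p\<close>, which the reconstruction
  reproduces exactly; so it drops out of the residual.\<close>

lemma residual_periodic:
  assumes T: "T \<in> M" and z: "z \<in> int_vecs"
  shows "residual ((+) z ` T) i (x + z) = residual T i x"
proof -
  interpret stencil p S w T by (rule stencil[OF T])
  define g where "g = (\<lambda>x. f (x + z) $ i - f x $ i)"
  have g: "g \<in> polys p" unfolding g_def by (rule polys_shift_diff[OF component_poly])
  have "cell_projection f ((+) z ` K) $ i = cell_projection f K $ i + cell_avg K g" if "K \<in> S T" for K
  proof -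
    have K: "compact K" "compact ((+) z ` K)"
      using compact stencil_in_mesh[OF T that] shift z by blast+
    have "cell_projection f ((+) z ` K) $ i = cell_avg K (\<lambda>x. f x $ i + g x)"
      unfolding cell_projection_def cell_avg_vec_nth[OF K(2) f_continuous]
      by (subst cell_avg_shift[OF K(1) polys_continuous[OF component_poly]]) (simp add: g_def)
    also have "\<dots> = cell_avg K (\<lambda>x. f x $ i) + cell_avg K g"
      by (intro cell_avg_add K polys_continuous[OF component_poly] polys_continuous[OF g])
    finally show ?thesis by (simp add: cell_projection_def cell_avg_vec_nth[OF K(1) f_continuous])
  qed
  then have "reconstruction p S w T (\<lambda>K. cell_projection f ((+) z ` K) $ i) = (\<lambda>x. recon T i x + g x)"
    unfolding recon_def by (subst reconstruction_add_polys[OF g, symmetric]) (rule reconstruction_cong)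
  moreover have "recon ((+) z ` T) i = (\<lambda>x. reconstruction p S w T (\<lambda>K. cell_projection f ((+) z ` K) $ i) (x - z))"
    unfolding recon_def
  proof (rule reconstruction_shift)
    show "S ((+) z ` T) = (\<lambda>K. (+) z ` K) ` S T"
      using admissible T z unfolding admissible_stencils_def by simp
    show "w ((+) z ` T) ((+) z ` K) = w T K" if "K \<in> S T" for K
      using admissible T z that unfolding admissible_stencils_def by simp
  qed
  ultimately show ?thesis by (simp add: residual_def g_def)
qed

definition face_residual :: "(real^'d) set \<Rightarrow> (real^'d) set \<Rightarrow> real^'n" where
  "face_residual T T' = (\<chi> i. face_avg (T \<inter> T') (residual T i))"

definition flux_error :: "(real^'d) set \<Rightarrow> (real^'d) set \<Rightarrow> real^'n" where
  "flux_error T T' = (let B = mat_dot A (normal_integral T T') in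
     ((1/2) *\<^sub>R (B + matrix_abs B)) *v face_residual T T' +
     ((1/2) *\<^sub>R (B - matrix_abs B)) *v face_residual T' T)"

text \<open>The two upwind weights add up to the full matrix, so replacing both traces by that of \<open>f\<close>
  gives the exact flux.\<close>

lemma upwind_flux_split:
  assumes T: "T \<in> M" and T': "T' \<in> neighbours M T"
  shows "upwind_flux A p S w T T' (cell_projection f)
       = mat_dot A (normal_integral T T') *v (\<chi> i. face_avg (T \<inter> T') (\<lambda>x. f x $ i)) - flux_error T T'"
proof -
  define y where "y = (\<chi> i. face_avg (T \<inter> T') (\<lambda>x. f x $ i))"
  have val: "face_value p S w K K' (cell_projection f) = y - face_residual K K'"
    if "K \<in> M" "K \<inter> K' = T \<inter> T'" for K K'
    using face_avg_diff[OF T T' polys_continuous[OF component_poly] recon_continuous[OF that(1)]]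
    by (simp add: vec_eq_iff face_value_def y_def face_residual_def residual_def that(2) recon_def[symmetric])
  have "(1/2) *\<^sub>R (B + D) *v (y - r) + (1/2) *\<^sub>R (B - D) *v (y - r')
      = B *v y - ((1/2) *\<^sub>R (B + D) *v r + (1/2) *\<^sub>R (B - D) *v r')" for B D :: "real^'n^'n" and r r'
  proof -
    have "(1/2) *\<^sub>R (B + D) + (1/2) *\<^sub>R (B - D) = B" by (simp add: algebra_simps flip: scaleR_add_left)
    then have "B *v y = (1/2) *\<^sub>R (B + D) *v y + (1/2) *\<^sub>R (B - D) *v y"
      by (metis matrix_vector_mult_add_rdistrib)
    then show ?thesis by (simp add: matrix_vector_mult_diff_distrib)
  qed
  then show ?thesis
    using val[OF T refl] val[OF neighbour_in_mesh[OF T'] Int_commute]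
    by (simp add: upwind_flux_def flux_error_def Let_def y_def)
qed

text \<open>Exchanging the cells reverses the normal. This exchanges the roles of the upwind weights up to
  sign, because \<open>B\<close> and \<open>- B\<close> have the same absolute value.\<close>

lemma flux_error_antisymmetric:
  assumes "T \<in> M" "T' \<in> neighbours M T" shows "flux_error T' T = - flux_error T T'"
proof -
  define B where "B = mat_dot A (normal_integral T T')"
  have "(1/2) *\<^sub>R (- B + matrix_abs B) = - ((1/2) *\<^sub>R (B - matrix_abs B))"
    "(1/2) *\<^sub>R (- B - matrix_abs B) = - ((1/2) *\<^sub>R (B + matrix_abs B))"
    by (simp_all add: scaleR_add_right scaleR_diff_right)
  moreover have "(- X) *v y = - (X *v y)" for X :: "real^'n^'n" and y
    by (simp add: vec_eq_iff matrix_vector_mult_def sum_negf)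
  ultimately show ?thesis
    by (simp only: flux_error_def Let_def normal_integral_sym[OF assms] mat_dot_uminus matrix_abs_uminus
        B_def[symmetric]) simp
qed

lemma flux_error_periodic:
  assumes T: "T \<in> M" and T': "T' \<in> neighbours M T" and z: "z \<in> int_vecs"
  shows "flux_error ((+) z ` T) ((+) z ` T') = flux_error T T'"
proof -
  have "face_residual ((+) z ` K) ((+) z ` K') = face_residual K K'"
    if K: "K \<in> M" "K' \<in> neighbours M K" for K K'
    using face_avg_normal_integral_shift(1)[OF K z residual_continuous[OF shift[OF K(1) z]]]
    by (simp add: face_residual_def residual_periodic[OF K(1) z])
  from this[OF T T'] this[OF neighbour_in_mesh[OF T'] neighbours_sym[OF T T']] show ?thesis
    by (simp add: flux_error_def face_avg_normal_integral_shift(2)[OF T T' z continuous_on_const])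
qed

text \<open>The divergence theorem for each component of \<open>f\<close>, combined with the coefficients of \<open>A\<close>.\<close>

lemma exact_flux_sum:
  assumes T: "T \<in> M"
  shows "(\<Sum>T'\<in>neighbours M T. mat_dot A (normal_integral T T') *v (\<chi> i. face_avg (T \<inter> T') (\<lambda>x. f x $ i)))
       = (LINT x:T|lborel. mat_dot_grad A f x)"
proof -
  have "\<forall>l. \<exists>G. has_continuous_gradient (\<lambda>x. f x $ l) G"
    using polys_continuous_gradient[OF component_poly] by metis
  then obtain G where G: "\<And>l. has_continuous_gradient (\<lambda>x. f x $ l) (G l)" by metis
  then have Gc: "continuous_on UNIV (G l)" and Gd: "((\<lambda>x. f x $ l) has_derivative (\<lambda>h. G l x \<bullet> h)) (at x)" for l x
    by (auto simp: has_continuous_gradient_def)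
  have "(f has_derivative (\<lambda>h. \<chi> l. G l x \<bullet> h)) (at x)" for x
  proof (subst has_derivative_componentwise_within, intro ballI)
    fix b :: "real^'n" assume "b \<in> Basis"
    then obtain l where "b = axis l 1" by (auto simp: Basis_vec_def)
    then show "((\<lambda>x. f x \<bullet> b) has_derivative (\<lambda>h. (\<chi> l. G l x \<bullet> h) \<bullet> b)) (at x)"
      using Gd[of l x] by (simp add: inner_axis)
  qed
  then have "frechet_derivative f (at x) = (\<lambda>h. \<chi> l. G l x \<bullet> h)" for x
    using frechet_derivative_at by metis
  then have grad: "mat_dot_grad A f x $ k = (\<Sum>i\<in>UNIV. \<Sum>l\<in>UNIV. A i $ k $ l * G l x $ i)" for x k
    by (simp add: mat_dot_grad_def matrix_vector_mult_def inner_axis)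
  have "continuous_on UNIV (\<lambda>x. \<chi> k. mat_dot_grad A f x $ k)"
    unfolding grad by (intro continuous_on_vec_lambda continuous_intros Gc)
  then have "continuous_on UNIV (mat_dot_grad A f)" by simp
  then have int: "set_integrable lborel T (mat_dot_grad A f)" by (rule compact_set_integrable[OF compact[OF T]])
  have intG: "set_integrable lborel T (G l)" for l by (rule compact_set_integrable[OF compact[OF T] Gc])
  have intGi: "set_integrable lborel T (\<lambda>x. G l x $ i)" for l i
    by (intro compact_set_integrable[OF compact[OF T]] continuous_intros Gc)
  show ?thesis
  proof (subst vec_eq_iff, intro allI)
    fix k
    have "(\<Sum>T'\<in>neighbours M T. mat_dot A (normal_integral T T') *v (\<chi> i. face_avg (T \<inter> T') (\<lambda>x. f x $ i))) $ k
        = (\<Sum>T'\<in>neighbours M T. \<Sum>i\<in>UNIV. \<Sum>l\<in>UNIV. A i $ k $ l *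
            (face_avg (T \<inter> T') (\<lambda>x. f x $ l) * normal_integral T T' $ i))"
      by (simp add: mat_dot_mult_component)
    also have "\<dots> = (\<Sum>i\<in>UNIV. \<Sum>l\<in>UNIV. A i $ k $ l *
        (\<Sum>T'\<in>neighbours M T. face_avg (T \<inter> T') (\<lambda>x. f x $ l) *\<^sub>R normal_integral T T') $ i)"
      by (simp add: sum_distrib_left sum.swap[of _ _ "neighbours M T"])
    also have "\<dots> = (\<Sum>i\<in>UNIV. \<Sum>l\<in>UNIV. A i $ k $ l * (LINT x:T|lborel. G l x $ i))"
      by (simp only: divergence_theorem_cell(2)[OF T G] set_integral_vec_nth[OF intG])
    also have "\<dots> = (LINT x|lborel. (\<Sum>i\<in>UNIV. \<Sum>l\<in>UNIV. A i $ k $ l * (indicator T x *\<^sub>R (G l x $ i))))"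
      using intGi unfolding set_lebesgue_integral_def set_integrable_def
      by (simp add: Bochner_Integration.integral_sum Bochner_Integration.integrable_sum)
    also have "\<dots> = (LINT x:T|lborel. \<Sum>i\<in>UNIV. \<Sum>l\<in>UNIV. A i $ k $ l * G l x $ i)"
      unfolding set_lebesgue_integral_def by (simp add: sum_distrib_left mult.left_commute)
    also have "\<dots> = (LINT x:T|lborel. mat_dot_grad A f x) $ k"
      by (simp add: set_integral_vec_nth[OF int] grad)
    finally show "(\<Sum>T'\<in>neighbours M T. mat_dot A (normal_integral T T') *v (\<chi> i. face_avg (T \<inter> T') (\<lambda>x. f x $ i))) $ k
        = (LINT x:T|lborel. mat_dot_grad A f x) $ k" .
  qed
qed

lemma truncation_error_eq:
  assumes T: "T \<in> M"
  shows "measure lborel T *\<^sub>R truncation_error A M p S w f T = - (\<Sum>T'\<in>neighbours M T. flux_error T T')"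
proof -
  have "(\<Sum>T'\<in>neighbours M T. upwind_flux A p S w T T' (cell_projection f))
      = (LINT x:T|lborel. mat_dot_grad A f x) - (\<Sum>T'\<in>neighbours M T. flux_error T T')"
    by (simp add: upwind_flux_split[OF T] sum_subtractf exact_flux_sum[OF T])
  then show ?thesis using measure_pos[OF T]
    by (simp add: truncation_error_def cell_projection_def cell_avg_def scaleR_add_right scaleR_diff_right)
qed

end

(* The sum over elements modulo translations is asserted for every choice of representatives. *)
theorem proposition7p1:
  fixes p :: nat
    and A :: "'d::finite \<Rightarrow> real^'n^'n"
    and M :: "(real^'d) set set"
    and S :: "'d stencils" and w :: "'d weights"
    and f :: "real^'d \<Rightarrow> real^'n"
    and rep :: "(real^'d) set set \<Rightarrow> (real^'d) set"
  assumes "hyperbolic A"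
    and "periodic_simplicial_mesh M"
    and "admissible_stencils p M S w"
    and "f \<in> poly_vecs (p + 1)"
    and "\<And>c. c \<in> elements_mod_translations M \<Longrightarrow> rep c \<in> c"
  shows "(\<Sum>c\<in>elements_mod_translations M.
            measure lborel (rep c) *\<^sub>R truncation_error A M p S w f (rep c)) = 0"
proof -
  interpret scheme M p A S w f by unfold_locales (use assms in auto)
  have "rep c \<in> M" if "c \<in> elements_mod_translations M" for c
    using assms(5)[OF that] that equiv_translation in_quotient_imp_subset by blast
  then have "(\<Sum>c\<in>elements_mod_translations M. measure lborel (rep c) *\<^sub>R truncation_error A M p S w f (rep c))
      = - (\<Sum>c\<in>elements_mod_translations M. \<Sum>T'\<in>neighbours M (rep c). flux_error (rep c) T')"
    by (simp add: truncation_error_eq sum_negf)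
  also have "\<dots> = 0"
    using antisymmetric_periodic_sum[where \<Phi> = flux_error and rep = rep]
      flux_error_antisymmetric flux_error_periodic assms(5) by simp
  finally show ?thesis .
qed

end
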